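(* $${}_2F_1\left(\tfrac35,\tfrac45;\tfrac32;\tfrac{125}{128}\right)=\frac43\,\frac{\sqrt2\,\sqrt[10]{3}\,\Gamma(1/5)^3\,\Gamma(2/5)}{(5+\sqrt5)^{3/2}\,\pi^2}.$$
   Context: For complex $a,b,c$ with $c\notin\{0,-1,-2,\dots\}$ and $|x|<1$, ${}_2F_1(a,b;c;x)=\sum_{n\ge 0}\frac{(a,n)(b,n)}{(c,n)(1,n)}x^n$ denotes Gauss's hypergeometric series, where $(\alpha,n)=\alpha(\alpha+1)\cdots(\alpha+n-1)$, $(\alpha,0)=1$. All roots are positive real roots. *)

theory Defs
  imports "HOL-Analysis.Analysis"
begin

text \<open>
  Gauss's series; its value is meaningful when \<open>c\<close> is not a nonpositive integer and
  \<open>norm x < 1\<close> (otherwise division by zero or a divergent series may occur).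
\<close>
definition gauss_2F1 :: "complex \<Rightarrow> complex \<Rightarrow> complex \<Rightarrow> complex \<Rightarrow> complex" where
  "gauss_2F1 a b c x =
     (\<Sum>n. pochhammer a n * pochhammer b n / (pochhammer c n * pochhammer 1 n) * x ^ n)"

lemma gauss_2F1_eq_eval_fps: "gauss_2F1 a b c x = eval_fps (fps_hypergeo [a, b] [c] 1) x"
  by (simp add: gauss_2F1_def eval_fps_def flip: pochhammer_fact)

end

(*
  Euler's transformation reduces the claim to 2F1(9/10,7/10;3/2;125/128). Expanding binomially and
  integrating termwise, that series becomes the integral over the real line of sgn P |P|^(-3/5)
  for a cubic P with one real root. The value 125/128 is special (a CM point) because there is a
  quartic polynomial s with

      s(x)^2 - 1 = x^5 P(x + 1/x),

  so that the sum of ds/(s^2 - 1)^(3/5) over the two points x, 1/x above t = x + 1/x equals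
  3 dt/P(t)^(3/5). The integral in t is thus expressed by incomplete beta integrals in s. For
  |t| > 2 the points x, 1/x are real; for |t| < 2 they are conjugate on the unit circle, and there
  the primitive has to be continued analytically. Along this arc s winds around the
  branch point 1 and reaches the other branch point -1 at the root of P, and the phases
  picked up on the two sides produce the factor cos(pi/5) + cos(2 pi/5) = sqrt 5 / 2.
*)

theory Submission
  imports Defs "HOL-Real_Asymp.Real_Asymp"
begin

unbundle no vec_syntax
unbundle fps_syntax

section \<open>Euler's transformation of Gauss's series\<close>

text \<open>The exponent -3/5 is forced twice. The odd terms of a binomial series with exponent 1 -
  (a + b) have coefficients proportional to Gamma(2n + a + b)/(2n + 1)!, and this Gamma factor has
  to cancel the denominator of the Beta integrals; Euler's transformation changes a + b from 7/5 to
  8/5. With exponent -3/5, moreover, the factor x^5 becomes x^(-3), free of roots, so that the sum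
  over x and 1/x can be simplified rationally. The obstacle is the choice of branches: on the upper
  half circle s goes round 1 twice, so no principal power of s - 1 is continuous there. The
  incomplete beta integral is therefore split into (s - 1)^(2/5), continued by hand, and a kernel
  that is regular at s = 1 and analytic off a slit ending at s = -1. The slit is met only at the
  root of P, where continuity is enough for the fundamental theorem of calculus. No incomplete beta
  value has to be computed: the pieces fit together at t = 2 and t = -2, the two infinite ends
  cancel, and only a complete beta integral at the root survives.\<close>

definition gauss_fps :: "'a::field_char_0 \<Rightarrow> 'a \<Rightarrow> 'a \<Rightarrow> 'a fps" where
  "gauss_fps a b c = Abs_fps (\<lambda>n. pochhammer a n * pochhammer b n / (pochhammer c n * fact n))"

text \<open>The left-hand side of Gauss's hypergeometric differential equation, for formal power
  series.\<close>

definition gauss_op :: "'a::field_char_0 \<Rightarrow> 'a \<Rightarrow> 'a \<Rightarrow> 'a fps \<Rightarrow> 'a fps" where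
  "gauss_op a b c f =
     fps_X * (1 - fps_X) * fps_deriv (fps_deriv f)
     + (fps_const c - fps_const (a + b + 1) * fps_X) * fps_deriv f - fps_const (a * b) * f"

lemma gauss_op_nth:
  "gauss_op a b c f $ n = of_nat (Suc n) * (c + of_nat n) * f $ Suc n
                          - (a + of_nat n) * (b + of_nat n) * f $ n"
proof (cases n)
  case 0
  then show ?thesis
    by (simp add: gauss_op_def mult.assoc algebra_simps)
next
  case (Suc m)
  have "gauss_op a b c f = fps_X * fps_deriv (fps_deriv f) - fps_X * (fps_X * fps_deriv (fps_deriv f))
     + fps_const c * fps_deriv f - fps_X * (fps_const (a + b + 1) * fps_deriv f) - fps_const (a * b) * f"
    by (simp add: gauss_op_def algebra_simps)
  then have "gauss_op a b c f $ n = \<dots> $ n" by (rule arg_cong)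
  also have "\<dots> = of_nat (Suc n) * (c + of_nat n) * f $ Suc n
                          - (a + of_nat n) * (b + of_nat n) * f $ n"
    by (cases m) (simp_all add: Suc algebra_simps)
  finally show ?thesis .
qed

text \<open>The equation is a first-order recurrence for the coefficients. Its leading factor (n +
  1)(c + n) never vanishes, so the constant term determines a power series solution.\<close>

lemma gauss_op_eq_0_iff:
  assumes "\<And>n. c \<noteq> - of_nat n"
  shows "gauss_op a b c f = 0 \<longleftrightarrow> f = fps_const (f $ 0) * gauss_fps a b c"
proof -
  have cn: "c + of_nat n \<noteq> 0" for n
    using assms[of n] by (metis add_eq_0_iff2)
  have pc: "pochhammer c n \<noteq> 0" for n
    using assms by (auto simp: pochhammer_eq_0_iff)
  have G: "gauss_fps a b c $ Suc n
      = (a + of_nat n) * (b + of_nat n) / (of_nat (Suc n) * (c + of_nat n)) * gauss_fps a b c $ n" for n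
    using cn[of n] pc[of n] by (simp add: gauss_fps_def pochhammer_Suc divide_simps)
  have nz: "of_nat (Suc n) * (c + of_nat n) \<noteq> 0" for n
    using cn[of n] by (simp del: of_nat_Suc)
  have "gauss_op a b c f = 0 \<longleftrightarrow> (\<forall>n. f $ Suc n
      = (a + of_nat n) * (b + of_nat n) / (of_nat (Suc n) * (c + of_nat n)) * f $ n)"
    using nz by (simp add: fps_eq_iff gauss_op_nth field_simps del: of_nat_Suc)
  also have "\<dots> \<longleftrightarrow> (\<forall>n. f $ n = f $ 0 * gauss_fps a b c $ n)"
  proof
    assume R: "\<forall>n. f $ Suc n
      = (a + of_nat n) * (b + of_nat n) / (of_nat (Suc n) * (c + of_nat n)) * f $ n"
    show "\<forall>n. f $ n = f $ 0 * gauss_fps a b c $ n"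
    proof
      fix n show "f $ n = f $ 0 * gauss_fps a b c $ n"
      proof (induction n)
        case 0 show ?case by (simp add: gauss_fps_def)
      next
        case (Suc n) then show ?case using R[rule_format, of n] G[of n] by (simp add: mult_ac)
      qed
    qed
  next
    assume R: "\<forall>n. f $ n = f $ 0 * gauss_fps a b c $ n"
    show "\<forall>n. f $ Suc n
      = (a + of_nat n) * (b + of_nat n) / (of_nat (Suc n) * (c + of_nat n)) * f $ n"
    proof
      fix n
      show "f $ Suc n = (a + of_nat n) * (b + of_nat n) / (of_nat (Suc n) * (c + of_nat n)) * f $ n"
        using R[rule_format, of "Suc n"] R[rule_format, of n] G[of n] by (metis mult.left_commute)
    qed
  qed
  finally show ?thesis by (simp add: fps_eq_iff)
qed

text \<open>The right-hand side satisfies the hypergeometric equation of the left-hand side and has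
  constant term 1, so uniqueness of the solution identifies them. Convergence plays no part on this
  formal level.\<close>

lemma gauss_fps_euler:
  fixes a b c :: "'a::field_char_0"
  assumes c: "\<And>n. c \<noteq> - of_nat n"
  shows "gauss_fps a b c = (fps_binomial (c - a - b) oo - fps_X) * gauss_fps (c - a) (c - b) c"
proof -
  define e where "e = c - a - b"
  define B where "B = fps_binomial e oo - fps_X"
  define f where "f = gauss_fps (c - a) (c - b) c"
  define B' where "B' = fps_deriv B"
  define f' where "f' = fps_deriv f"
  define B2 where "B2 = fps_deriv B'"
  define f2 where "f2 = fps_deriv f'"
  let ?X = "fps_X :: 'a fps"
  let ?c = fps_const
  have "B = Abs_fps (\<lambda>n. (-1) ^ n * (e gchoose n))"
    unfolding B_def by (simp add: fps_compose_uminus')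
  then have Bn: "B $ n = (-1) ^ n * (e gchoose n)" for n by simp
  \<comment> \<open>The differential equation of (1 - X)^e; together with its derivative it is all
    that is used about \<open>B\<close> apart from \<open>B $ 0\<close>.\<close>
  have B1: "(1 - ?X) * B' = - ?c e * B"
  proof (rule fps_ext)
    fix n
    have *: "of_nat (Suc n) * (e gchoose Suc n) = (e - of_nat n) * (e gchoose n)"
      by (metis gbinomial_absorb_comp gbinomial_absorption)
    show "((1 - ?X) * B') $ n = (- ?c e * B) $ n"
    proof (cases n)
      case 0 then show ?thesis using * by (simp add: B'_def Bn algebra_simps)
    next
      case (Suc m)
      have "((1 - ?X) * B') $ n = B' $ n - B' $ m" by (simp add: Suc algebra_simps)
      also have "\<dots> = - ((-1) ^ n * (of_nat (Suc n) * (e gchoose Suc n))) - of_nat n * ((-1) ^ n * (e gchoose n))"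
        by (simp add: B'_def Bn Suc algebra_simps del: gbinomial_Suc)
      also have "\<dots> = - e * ((-1) ^ n * (e gchoose n))"
        unfolding * by (simp add: algebra_simps)
      finally show ?thesis by (simp add: Bn fps_mult_left_const_nth flip: fps_const_neg)
    qed
  qed
  have B2': "(1 - ?X) * B2 - B' = - ?c e * B'"
    using arg_cong[OF B1, of fps_deriv] by (simp add: B2_def B'_def flip: fps_const_neg)
  have f0: "gauss_op (c - a) (c - b) c f = 0"
    by (subst gauss_op_eq_0_iff[OF c]) (simp add: f_def gauss_fps_def)
  have ab: "a = c - b - e" by (simp add: e_def)
  \<comment> \<open>With a eliminated in favour of e, every coefficient is a polynomial in
    \<open>C\<close>, \<open>E\<close>, \<open>Q\<close> and X, so that the claim becomes ideal
    membership.\<close>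
  define C where "C = ?c c"
  define E where "E = ?c e"
  define Q where "Q = ?c b"
  have f0': "?X * (1 - ?X) * f2 + (C - (Q + E + C - Q + 1) * ?X) * f' - (Q + E) * (C - Q) * f = 0"
    using f0 by (simp add: gauss_op_def f2_def f'_def C_def E_def Q_def ab flip: fps_const_add fps_const_sub fps_const_mult)
  have y2: "fps_deriv (fps_deriv (B * f)) = B2 * f + 2 * B' * f' + B * f2"
    by (simp add: B2_def f2_def B'_def f'_def algebra_simps)
  have y1: "fps_deriv (B * f) = B' * f + B * f'"
    by (simp add: B'_def f'_def algebra_simps)
  have k: "?c (a + b + 1) = C - E + 1" "?c (a * b) = (C - Q - E) * Q" "?c c = C"
    by (simp_all add: ab C_def E_def Q_def flip: fps_const_sub)
  have "gauss_op a b c (B * f) = ?X * (1 - ?X) * (B2 * f + 2 * B' * f' + B * f2)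
      + (C - (C - E + 1) * ?X) * (B' * f + B * f') - (C - Q - E) * Q * (B * f)"
    unfolding gauss_op_def y2 unfolding y1 k ..
  \<comment> \<open>The extra factor 1 - X allows both derivatives of \<open>B\<close> to be
    eliminated without division; it is cancelled afterwards.\<close>
  also have "(1 - ?X) * \<dots> = 0"
  proof -
    note B1 = B1[folded E_def] and B2' = B2'[folded E_def]
    show ?thesis using B1 B2' f0' by algebra
  qed
  finally have "(1 - ?X) * gauss_op a b c (B * f) = 0" .
  moreover have "(1 - ?X) \<noteq> 0"
    by (metis fps_one_nth fps_sub_nth fps_X_nth fps_zero_nth diff_zero zero_neq_one)
  ultimately have "gauss_op a b c (B * f) = 0" by simp
  then have "B * f = fps_const ((B * f) $ 0) * gauss_fps a b c"
    using gauss_op_eq_0_iff[OF c] by blast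
  also have "(B * f) $ 0 = 1"
    by (simp add: Bn f_def gauss_fps_def)
  finally show ?thesis by (simp add: B_def f_def e_def)
qed

lemma gauss_2F1_conv_eval_fps: "gauss_2F1 a b c x = eval_fps (gauss_fps a b c) x"
  by (simp add: gauss_2F1_def eval_fps_def gauss_fps_def pochhammer_fact)

text \<open>Ratio test. The conditions on \<open>a\<close> and \<open>b\<close> keep the
  coefficients nonzero; a terminating series would have infinite radius.\<close>

lemma fps_conv_radius_gauss_fps:
  fixes a b c :: complex
  assumes "\<And>n. a \<noteq> - of_nat n" "\<And>n. b \<noteq> - of_nat n" "\<And>n. c \<noteq> - of_nat n"
  shows "fps_conv_radius (gauss_fps a b c) = 1"
  unfolding fps_conv_radius_def
proof (rule conv_radius_ratio_limit_nonzero)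
  have nz: "a + of_nat n \<noteq> 0" "b + of_nat n \<noteq> 0" "c + of_nat n \<noteq> 0" for n
    using assms[of n] by (metis add_eq_0_iff2)+
  have p: "pochhammer a n \<noteq> 0" "pochhammer b n \<noteq> 0" "pochhammer c n \<noteq> 0" for n
    using assms by (auto simp: pochhammer_eq_0_iff)
  have lim: "(\<lambda>n. norm (d + of_nat n) / real (Suc n)) \<longlonglongrightarrow> 1" for d :: complex
  proof -
    have "(\<lambda>n. of_nat n / of_nat (Suc n) :: complex) \<longlonglongrightarrow> 1"
      using LIMSEQ_n_over_Suc_n .
    moreover have "(\<lambda>n. d / of_nat (Suc n)) \<longlonglongrightarrow> 0"
      using LIMSEQ_Suc[OF lim_const_over_n[of d]] by simp
    ultimately have "(\<lambda>n. norm (d / of_nat (Suc n) + of_nat n / of_nat (Suc n))) \<longlonglongrightarrow> norm (0 + 1 :: complex)"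
      by (intro tendsto_norm tendsto_add)
    then show ?thesis
      by (simp add: norm_divide del: of_nat_Suc flip: add_divide_distrib)
  qed
  have "(\<lambda>n. (norm (c + of_nat n) / real (Suc n) * (norm (1 + of_nat n :: complex) / real (Suc n)))
         / ((norm (a + of_nat n) / real (Suc n)) * (norm (b + of_nat n) / real (Suc n)))) \<longlonglongrightarrow> (1 * 1) / (1 * 1)"
    by (intro tendsto_divide tendsto_mult lim) auto
  also have "(\<lambda>n. (norm (c + of_nat n) / real (Suc n) * (norm (1 + of_nat n :: complex) / real (Suc n)))
         / ((norm (a + of_nat n) / real (Suc n)) * (norm (b + of_nat n) / real (Suc n))))
     = (\<lambda>n. norm (gauss_fps a b c $ n) / norm (gauss_fps a b c $ Suc n))"
  proof
    fix n
    have f: "fact (Suc n) = (1 + of_nat n) * (fact n :: complex)" by simp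
    show "(norm (c + of_nat n) / real (Suc n) * (norm (1 + of_nat n :: complex) / real (Suc n)))
         / ((norm (a + of_nat n) / real (Suc n)) * (norm (b + of_nat n) / real (Suc n)))
      = norm (gauss_fps a b c $ n) / norm (gauss_fps a b c $ Suc n)"
      unfolding gauss_fps_def fps_nth_Abs_fps pochhammer_Suc f norm_mult norm_divide
      using p[of n] nz[of n] by (simp add: divide_simps del: of_nat_Suc norm_fact)
  qed
  finally show "(\<lambda>n. norm (gauss_fps a b c $ n) / norm (gauss_fps a b c $ Suc n)) \<longlonglongrightarrow> 1" by simp
qed (simp_all add: one_ereal_def)

lemma gauss_2F1_euler:
  assumes "\<And>n. a \<noteq> - of_nat n" "\<And>n. b \<noteq> - of_nat n" "\<And>n. c \<noteq> - of_nat n"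
    and "\<And>n. c - a \<noteq> - of_nat n" "\<And>n. c - b \<noteq> - of_nat n" and x: "norm x < 1"
  shows "gauss_2F1 a b c x = (1 - x) powr (c - a - b) * gauss_2F1 (c - a) (c - b) c x"
proof -
  let ?B = "fps_binomial (c - a - b) oo - fps_X"
  have nth: "?B $ n = (-1) ^ n * fps_binomial (c - a - b) $ n" for n
    by (simp add: fps_compose_uminus')
  have "fps_conv_radius ?B = fps_conv_radius (fps_binomial (c - a - b))"
    unfolding fps_conv_radius_def by (rule conv_radius_cong) (simp add: nth norm_mult norm_power)
  also have "\<dots> \<ge> 1" by (simp add: fps_conv_radius_binomial)
  finally have r: "fps_conv_radius ?B \<ge> 1" .
  have "eval_fps ?B x = eval_fps (fps_binomial (c - a - b)) (- x)"
    unfolding eval_fps_def nth by (intro suminf_cong) (simp add: power_minus[of x] mult_ac)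
  also have "\<dots> = (1 - x) powr (c - a - b)"
    using x by (simp add: eval_fps_binomial)
  finally have *: "eval_fps ?B x = (1 - x) powr (c - a - b)" .
  have "ereal (norm x) < 1" using x by simp
  with r have "ereal (norm x) < fps_conv_radius ?B" by (rule less_le_trans[rotated])
  with \<open>ereal (norm x) < 1\<close> show ?thesis
    unfolding gauss_2F1_conv_eval_fps gauss_fps_euler[OF assms(3), of a b]
    by (subst eval_fps_mult)
       (use fps_conv_radius_gauss_fps[of "c-a" "c-b" c] assms in \<open>simp_all add: *\<close>)
qed

section \<open>The incomplete beta integral\<close>

text \<open>
  The integral of \<open>(s\<^sup>2 - 1)\<close> to the power \<open>-3/5\<close> from \<open>1\<close> to \<open>1 + z\<close> is
  \<open>5/2 * z powr (2/5) * beta_kernel z\<close>; the substitution \<open>s = 1 + \<rho> powr (5/2) * z\<close> makes the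
  integrand continuous, so that the kernel is analytic at the branch point \<open>z = 0\<close>.
\<close>

definition beta_kernel :: "complex \<Rightarrow> complex" where
  "beta_kernel z = integral {0..1} (\<lambda>\<rho>. (2 + of_real (\<rho> powr (5/2)) * z) powr (-3/5))"

lemma continuous_on_powr_notin_nonpos_Reals:
  fixes f :: "'a::topological_space \<Rightarrow> complex"
  assumes "continuous_on S f" "\<And>x. x \<in> S \<Longrightarrow> f x \<notin> \<real>\<^sub>\<le>\<^sub>0"
  shows "continuous_on S (\<lambda>x. f x powr c)"
proof -
  have "continuous_on S (\<lambda>x. exp (c * Ln (f x)))"
    using assms by (intro continuous_intros)
  moreover have "f x \<noteq> 0" if "x \<in> S" for x using assms(2)[OF that] by auto
  ultimately show ?thesis by (simp add: powr_def cong: continuous_on_cong)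
qed

text \<open>The slit from -2 to the left is radial as seen from 0, so its complement is star-shaped
  about 0 and contains the path of integration of \<open>beta_kernel\<close>.\<close>

lemma segment_notin_nonpos_Reals:
  fixes z :: complex
  assumes z: "2 + z \<notin> \<real>\<^sub>\<le>\<^sub>0" and u: "0 \<le> u" "u \<le> 1"
  shows "2 + of_real u * z \<notin> \<real>\<^sub>\<le>\<^sub>0"
proof
  assume *: "2 + of_real u * z \<in> \<real>\<^sub>\<le>\<^sub>0"
  then have u0: "u \<noteq> 0" by (auto simp: complex_nonpos_Reals_iff)
  with * have "Im z = 0" "2 + u * Re z \<le> 0"
    by (auto simp: complex_nonpos_Reals_iff)
  with z have "Re z > -2"
    by (auto simp: complex_nonpos_Reals_iff)
  then have "u * Re z \<ge> u * (-2)" using u by (intro mult_left_mono) auto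
  moreover have "u * Re z > u * (-2)"
    using \<open>Re z > -2\<close> u0 u by (intro mult_strict_left_mono) auto
  ultimately show False using \<open>2 + u * Re z \<le> 0\<close> u by linarith
qed

lemma powr_5_2_le_1: "0 \<le> \<rho> \<Longrightarrow> \<rho> \<le> 1 \<Longrightarrow> \<rho> powr (5/2) \<le> (1::real)"
  by (simp add: powr_le1)

text \<open>The equation says that 5/2 z^(2/5) B(z) has derivative (z (2 + z))^(-3/5), with the
  power of z divided out. In this form it is independent of the branch of that power, which is what
  the arc requires.\<close>

lemma beta_kernel_has_field_derivative:
  assumes z0: "2 + z0 \<notin> \<real>\<^sub>\<le>\<^sub>0"
  obtains D where "(beta_kernel has_field_derivative D) (at z0)"
    and "beta_kernel z0 + 5/2 * z0 * D = (2 + z0) powr (-3/5)"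
proof -
  define f where "f z \<rho> = (2 + of_real (\<rho> powr (5/2)) * z) powr (-3/5)" for z :: complex and \<rho> :: real
  define f' where "f' z \<rho> = of_real (\<rho> powr (5/2)) * (-3/5) * (2 + of_real (\<rho> powr (5/2)) * z) powr (-8/5)"
    for z :: complex and \<rho> :: real
  have "open ((\<lambda>z::complex. 2 + z) -` (- \<real>\<^sub>\<le>\<^sub>0))"
    by (intro open_vimage) (auto intro!: continuous_intros)
  then obtain e where e: "e > 0" and ball: "ball z0 e \<subseteq> (\<lambda>z::complex. 2 + z) -` (- \<real>\<^sub>\<le>\<^sub>0)"
    using z0 by (metis ComplI open_contains_ball vimageI)
  define U where "U = ball z0 e"
  have U: "2 + of_real (\<rho> powr (5/2)) * z \<notin> \<real>\<^sub>\<le>\<^sub>0" if "z \<in> U" "\<rho> \<in> {0..1}" for z \<rho>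
    using ball that by (intro segment_notin_nonpos_Reals powr_5_2_le_1) (auto simp: U_def)
  have cf: "continuous_on {0..1} (f z)" if "z \<in> U" for z
    unfolding f_def using U[OF that]
    by (intro continuous_on_powr_notin_nonpos_Reals continuous_intros continuous_on_powr') auto
  have cf': "continuous_on (U \<times> {0..1}) (\<lambda>(z, \<rho>). f' z \<rho>)"
    unfolding f'_def case_prod_unfold using U
    by (intro continuous_on_powr_notin_nonpos_Reals continuous_intros continuous_on_powr') auto
  have "((\<lambda>z. integral (cbox 0 1) (f z)) has_field_derivative integral (cbox 0 1) (f' z0)) (at z0 within U)"
  proof (rule leibniz_rule_field_derivative)
    fix z \<rho> assume "z \<in> U" "\<rho> \<in> cbox 0 (1::real)"
    then have "2 + of_real (\<rho> powr (5/2)) * z \<notin> \<real>\<^sub>\<le>\<^sub>0" using U by auto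
    then show "((\<lambda>z. f z \<rho>) has_field_derivative f' z \<rho>) (at z within U)"
      unfolding f_def f'_def by (auto intro!: derivative_eq_intros)
  qed (use cf cf' e in \<open>auto intro: integrable_continuous_real simp: U_def\<close>)
  then have D: "(beta_kernel has_field_derivative integral {0..1} (f' z0)) (at z0)"
    unfolding beta_kernel_def[abs_def] f_def[symmetric] using e
    by (simp add: U_def at_within_open[of _ "ball z0 e"])
  have z0U: "z0 \<in> U" using e by (simp add: U_def)
  \<comment> \<open>\<open>f\<close> depends on \<rho> and z only through \<rho>^(5/2) z, so the
    operator \<rho> d/d\<rho> acts on it as 5/2 z d/dz. Hence this integrand is the derivative of
    \<rho> f.\<close>
  have "((\<lambda>\<rho>. f z0 \<rho> + 5/2 * z0 * f' z0 \<rho>) has_integral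
          (of_real 1 * f z0 1 - of_real 0 * f z0 0)) {0..1}"
  proof (rule fundamental_theorem_of_calculus_interior)
    show "continuous_on {0..1} (\<lambda>\<rho>. of_real \<rho> * f z0 \<rho>)"
      by (intro continuous_intros cf z0U)
    fix \<rho> :: real assume \<rho>: "\<rho> \<in> {0<..<1}"
    then have n: "2 + of_real (\<rho> powr (5/2)) * z0 \<notin> \<real>\<^sub>\<le>\<^sub>0" using U z0U by auto
    have u: "((\<lambda>\<rho>. \<rho> powr (5/2)) has_real_derivative (5/2 * \<rho> powr (3/2))) (at \<rho>)"
      using \<rho> by (auto intro!: derivative_eq_intros)
    have "((\<lambda>\<rho>. 2 + of_real (\<rho> powr (5/2)) * z0) has_vector_derivative
        (of_real (5/2 * \<rho> powr (3/2)) * z0)) (at \<rho>)"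
      using has_vector_derivative_add[OF has_vector_derivative_const
          has_vector_derivative_mult_left[OF has_vector_derivative_of_real[OF u]], of 2 z0] by simp
    moreover have "((\<lambda>w. w powr (-3/5)) has_field_derivative
        (-3/5) * (2 + of_real (\<rho> powr (5/2)) * z0) powr (-8/5)) (at (2 + of_real (\<rho> powr (5/2)) * z0))"
      using n by (auto intro!: derivative_eq_intros)
    ultimately have "(((\<lambda>w. w powr (-3/5)) \<circ> (\<lambda>\<rho>. 2 + of_real (\<rho> powr (5/2)) * z0)) has_vector_derivative
       (of_real (5/2 * \<rho> powr (3/2)) * z0) * ((-3/5) * (2 + of_real (\<rho> powr (5/2)) * z0) powr (-8/5))) (at \<rho>)"
      by (rule field_vector_diff_chain_at)
    then have "(f z0 has_vector_derivative
       (of_real (5/2 * \<rho> powr (3/2)) * z0) * ((-3/5) * (2 + of_real (\<rho> powr (5/2)) * z0) powr (-8/5))) (at \<rho>)"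
      by (simp add: f_def[abs_def] o_def)
    then have "((\<lambda>\<rho>. of_real \<rho> * f z0 \<rho>) has_vector_derivative
       of_real \<rho> * ((of_real (5/2 * \<rho> powr (3/2)) * z0) * ((-3/5) * (2 + of_real (\<rho> powr (5/2)) * z0) powr (-8/5)))
        + of_real 1 * f z0 \<rho>) (at \<rho>)"
      by (intro has_vector_derivative_mult has_vector_derivative_of_real) auto
    moreover have "\<rho> powr (5/2) = \<rho> * \<rho> powr (3/2)"
      using \<rho> powr_mult_base[of \<rho> "3/2"] by simp
    ultimately show "((\<lambda>\<rho>. of_real \<rho> * f z0 \<rho>) has_vector_derivative f z0 \<rho> + 5/2 * z0 * f' z0 \<rho>) (at \<rho>)"
      by (simp add: f'_def algebra_simps)
  qed auto
  moreover have "((\<lambda>\<rho>. f z0 \<rho> + 5/2 * z0 * f' z0 \<rho>) has_integral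
      (integral {0..1} (f z0) + 5/2 * z0 * integral {0..1} (f' z0))) {0..1}"
  proof (intro has_integral_add has_integral_mult_right integrable_integral)
    show "f z0 integrable_on {0..1}" using cf z0U by (blast intro: integrable_continuous_real)
    have "continuous_on {0..1} (\<lambda>\<rho>. (\<lambda>(z, \<rho>). f' z \<rho>) (z0, \<rho>))"
      by (rule continuous_on_compose2[OF cf']) (use z0U in \<open>auto intro!: continuous_intros\<close>)
    then show "f' z0 integrable_on {0..1}" by (auto intro: integrable_continuous_real)
  qed
  ultimately have "integral {0..1} (f z0) + 5/2 * z0 * integral {0..1} (f' z0) = f z0 1"
    by (metis (no_types, lifting) diff_zero has_integral_unique mult_1 mult_zero_left of_real_0 of_real_1)
  then have "beta_kernel z0 + 5/2 * z0 * integral {0..1} (f' z0) = (2 + z0) powr (-3/5)"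
    by (simp add: beta_kernel_def f_def[abs_def])
  with D show ?thesis by (rule that)
qed

text \<open>The substitution u = \<rho>^(5/2) yields the complete beta integral. Up to a power of 2
  this is the kernel at the end of its slit.\<close>

lemma has_integral_one_minus_powr:
  "((\<lambda>\<rho>. (1 - \<rho> powr (5/2)) powr (-3/5)) has_integral 2/5 * Beta (2/5) (2/5 :: real)) {0<..<1}"
proof -
  define g where "g \<rho> = \<rho> powr (5/2)" for \<rho> :: real
  define f where "f u = u powr (2/5 - 1) * (1 - u) powr (2/5 - 1)" for u :: real
  have img: "g ` {0<..<1} = {0<..<1}"
  proof (intro equalityI subsetI)
    fix u assume "u \<in> g ` {0<..<1}"
    then show "u \<in> {0<..<1}" using powr_less_mono2[of "5/2" _ 1] by (auto simp: g_def)
  next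
    fix u :: real assume "u \<in> {0<..<1}"
    then have "u = g (u powr (2/5))" "u powr (2/5) \<in> {0<..<1}"
      using powr_less_mono2[of "2/5" u 1] by (auto simp: g_def powr_powr)
    then show "u \<in> g ` {0<..<1}" by blast
  qed
  have I: "(f has_integral Beta (2/5) (2/5)) {0<..<1}"
    unfolding f_def using has_integral_Beta_real[of "2/5" "2/5"] by (simp add: has_integral_Icc_iff_Ioo)
  have "f absolutely_integrable_on {0<..<1}"
    using I by (intro nonnegative_absolutely_integrable_1) (auto simp: f_def integrable_on_def)
  then have "f absolutely_integrable_on (g ` {0<..<1}) \<and> integral (g ` {0<..<1}) f = Beta (2/5) (2/5)"
    using I by (simp add: img integral_unique)
  moreover have "(\<lambda>\<rho>. \<bar>5/2 * \<rho> powr (3/2)\<bar> * f (g \<rho>)) absolutely_integrable_on {0<..<1} \<and>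
       integral {0<..<1} (\<lambda>\<rho>. \<bar>5/2 * \<rho> powr (3/2)\<bar> * f (g \<rho>)) = Beta (2/5) (2/5)
     \<longleftrightarrow> f absolutely_integrable_on (g ` {0<..<1}) \<and> integral (g ` {0<..<1}) f = Beta (2/5) (2/5)"
  proof (rule has_absolute_integral_change_of_variables_1')
    show "inj_on g {0<..<1}"
      by (rule inj_on_inverseI[of _ "\<lambda>x. x powr (2/5)"]) (auto simp: g_def powr_powr)
    show "(g has_field_derivative 5/2 * \<rho> powr (3/2)) (at \<rho> within {0<..<1})" if "\<rho> \<in> {0<..<1}" for \<rho>
      unfolding g_def[abs_def] using that by (auto intro!: derivative_eq_intros)
  qed auto
  ultimately have "(\<lambda>\<rho>. \<bar>5/2 * \<rho> powr (3/2)\<bar> * f (g \<rho>)) absolutely_integrable_on {0<..<1} \<and>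
       integral {0<..<1} (\<lambda>\<rho>. \<bar>5/2 * \<rho> powr (3/2)\<bar> * f (g \<rho>)) = Beta (2/5) (2/5)"
    by blast
  then have "((\<lambda>\<rho>. \<bar>5/2 * \<rho> powr (3/2)\<bar> * f (g \<rho>)) has_integral Beta (2/5) (2/5)) {0<..<1}"
    by (auto simp: has_integral_iff intro: set_lebesgue_integral_eq_integral(1))
  then have "((\<lambda>\<rho>. 2/5 * (\<bar>5/2 * \<rho> powr (3/2)\<bar> * f (g \<rho>))) has_integral 2/5 * Beta (2/5) (2/5)) {0<..<1}"
    by (rule has_integral_mult_right)
  then show ?thesis
  proof (rule has_integral_eq[rotated])
    fix \<rho> :: real assume "\<rho> \<in> {0<..<1}"
    then have "\<rho> powr (3/2) * g \<rho> powr (-3/5) = 1"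
      by (simp add: g_def powr_powr flip: powr_add)
    with \<open>\<rho> \<in> {0<..<1}\<close> show "2/5 * (\<bar>5/2 * \<rho> powr (3/2)\<bar> * f (g \<rho>)) = (1 - \<rho> powr (5/2)) powr (-3/5)"
      by (simp add: f_def g_def)
  qed
qed

text \<open>Removes the endpoint \<rho> = 1, where the integrand degenerates for
  \<open>z = -2\<close>, so that pointwise statements hold on the whole domain.\<close>

lemma beta_kernel_alt:
  "beta_kernel z = integral {0<..<1} (\<lambda>\<rho>. (2 + of_real (\<rho> powr (5/2)) * z) powr (-3/5))"
  unfolding beta_kernel_def by (rule integral_open_interval_real)

lemma beta_kernel_minus_2: "beta_kernel (-2) = of_real (2 powr (-3/5) * (2/5 * Beta (2/5) (2/5)))"
proof -
  have "((\<lambda>\<rho>. of_real (2 powr (-3/5) * (1 - \<rho> powr (5/2)) powr (-3/5)) :: complex) has_integral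
      of_real (2 powr (-3/5) * (2/5 * Beta (2/5) (2/5)))) {0<..<1}"
    by (intro has_integral_of_real has_integral_mult_right has_integral_one_minus_powr)
  then have "((\<lambda>\<rho>. (2 + of_real (\<rho> powr (5/2)) * (-2)) powr (-3/5) :: complex) has_integral
      of_real (2 powr (-3/5) * (2/5 * Beta (2/5) (2/5)))) {0<..<1}"
  proof (rule has_integral_eq[rotated])
    fix \<rho> :: real assume \<rho>: "\<rho> \<in> {0<..<1}"
    define w where "w = \<rho> powr (5/2)"
    have w: "w < 1" using powr_less_mono2[of "5/2" \<rho> 1] \<rho> by (simp add: w_def)
    have "(2 + of_real w * (-2) :: complex) powr (-3/5) = of_real (2 * (1 - w)) powr of_real (-3/5)"
      by (simp add: right_diff_distrib mult.commute)
    also have "\<dots> = of_real ((2 * (1 - w)) powr (-3/5))"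
      using w by (intro powr_of_real) auto
    also have "(2 * (1 - w)) powr (-3/5) = 2 powr (-3/5) * (1 - w) powr (-3/5)"
      using w by (simp only: powr_mult)
    finally show "of_real (2 powr (-3/5) * (1 - \<rho> powr (5/2)) powr (-3/5))
        = (2 + of_real (\<rho> powr (5/2)) * (-2) :: complex) powr (-3/5)"
      by (simp add: w_def)
  qed
  then show ?thesis by (simp add: beta_kernel_alt integral_unique)
qed

text \<open>At the tip of the slit the kernel need not be analytic. The lower bound controls how the
  segments from 0 to \<open>z n\<close> approach the singularity and supplies a multiple of (1 -
  \<rho>^(5/2))^(-3/5) as an integrable majorant.\<close>

lemma beta_kernel_tendsto_minus_2:
  assumes z: "z \<longlonglongrightarrow> -2" and c: "c > 0"
    and D: "\<And>n. 2 + z n \<notin> \<real>\<^sub>\<le>\<^sub>0"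
    and bnd: "\<And>n u. 0 \<le> u \<Longrightarrow> u \<le> 1 \<Longrightarrow> norm (2 + of_real u * z n) \<ge> c * (1 - u)"
  shows "(\<lambda>n. beta_kernel (z n)) \<longlonglongrightarrow> beta_kernel (-2)"
  unfolding beta_kernel_alt
proof (rule dominated_convergence)
  fix n
  have "continuous_on {0..1} (\<lambda>\<rho>. (2 + of_real (\<rho> powr (5/2)) * z n) powr (-3/5))"
    using segment_notin_nonpos_Reals[OF D] powr_5_2_le_1
    by (intro continuous_on_powr_notin_nonpos_Reals continuous_intros continuous_on_powr') auto
  then show "(\<lambda>\<rho>. (2 + of_real (\<rho> powr (5/2)) * z n) powr (-3/5)) integrable_on {0<..<1}"
    by (simp add: integrable_continuous_real flip: integrable_on_Icc_iff_Ioo)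
  show "(\<lambda>\<rho>. c powr (-3/5) * (1 - \<rho> powr (5/2)) powr (-3/5)) integrable_on {0<..<1}"
    using has_integral_one_minus_powr by (intro integrable_on_mult_right) (auto simp: integrable_on_def)
  fix \<rho> :: real assume \<rho>: "\<rho> \<in> {0<..<1}"
  then have u: "\<rho> powr (5/2) < 1" using powr_less_mono2[of "5/2" \<rho> 1] by simp
  have e: "(-3/5 :: complex) = of_real (-3/5)" by simp
  have "norm ((2 + of_real (\<rho> powr (5/2)) * z n) powr (-3/5)) = norm (2 + of_real (\<rho> powr (5/2)) * z n) powr (-3/5)"
    unfolding e by (subst norm_powr_real_powr') auto
  also have "\<dots> \<le> (c * (1 - \<rho> powr (5/2))) powr (-3/5)"
    using bnd[of "\<rho> powr (5/2)" n] u c by (intro powr_mono2') auto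
  finally show "norm ((2 + of_real (\<rho> powr (5/2)) * z n) powr (-3/5)) \<le> c powr (-3/5) * (1 - \<rho> powr (5/2)) powr (-3/5)"
    using c u by (simp add: powr_mult)
  have "2 + of_real (\<rho> powr (5/2)) * (-2) \<notin> (\<real>\<^sub>\<le>\<^sub>0 :: complex set)"
    using u by (auto simp: complex_nonpos_Reals_iff)
  then show "(\<lambda>n. (2 + of_real (\<rho> powr (5/2)) * z n) powr (-3/5)) \<longlonglongrightarrow> (2 + of_real (\<rho> powr (5/2)) * (-2)) powr (-3/5)"
    using z by (intro tendsto_intros) auto
qed

text \<open>The variable is s - 1, the distance from the branch point. For positive arguments the
  kernel is real and \<open>Re\<close> only changes the type.\<close>

definition incomplete_beta :: "real \<Rightarrow> real" where
  "incomplete_beta x = 5/2 * x powr (2/5) * Re (beta_kernel (of_real x))"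

lemma incomplete_beta_has_derivative:
  assumes x: "x > 0"
  shows "(incomplete_beta has_real_derivative (x * (x + 2)) powr (-3/5)) (at x)"
proof -
  have "2 + of_real x \<notin> (\<real>\<^sub>\<le>\<^sub>0 :: complex set)"
    using x by (auto simp: complex_nonpos_Reals_iff)
  then obtain D where D: "(beta_kernel has_field_derivative D) (at (of_real x))"
    and eq: "beta_kernel (of_real x) + 5/2 * of_real x * D = (2 + of_real x) powr (-3/5)"
    by (rule beta_kernel_has_field_derivative)
  have "((\<lambda>x. beta_kernel (of_real x)) has_vector_derivative D) (at x)"
    by (rule has_vector_derivative_real_field) (rule D)
  then have Re: "((\<lambda>x. Re (beta_kernel (of_real x))) has_real_derivative Re D) (at x)"
    by (simp add: has_vector_derivative_complex_iff)
  have "(2 + of_real x :: complex) powr (-3/5) = of_real (2 + x) powr of_real (-3/5)" by simp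
  also have "\<dots> = of_real ((2 + x) powr (-3/5))"
    using x by (intro powr_of_real) auto
  finally have eq': "Re (beta_kernel (of_real x)) + 5/2 * x * Re D = (2 + x) powr (-3/5)"
    using arg_cong[OF eq, of Re] by simp
  have x': "x powr (2/5) = x * x powr (-3/5)"
    using x powr_mult_base[of x "-3/5"] by simp
  have "(incomplete_beta has_real_derivative
      (5/2 * (2/5 * x powr (-3/5))) * Re (beta_kernel (of_real x)) + Re D * (5/2 * x powr (2/5))) (at x)"
    unfolding incomplete_beta_def[abs_def]
  proof (rule DERIV_mult[OF _ Re])
    show "((\<lambda>x. 5/2 * x powr (2/5)) has_real_derivative 5/2 * (2/5 * x powr (-3/5))) (at x)"
      using x by (auto intro!: derivative_eq_intros)
  qed
  also have "(5/2 * (2/5 * x powr (-3/5))) * Re (beta_kernel (of_real x)) + Re D * (5/2 * x powr (2/5))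
      = x powr (-3/5) * (Re (beta_kernel (of_real x)) + 5/2 * x * Re D)"
    unfolding x' by (simp add: algebra_simps)
  also have "\<dots> = (x * (x + 2)) powr (-3/5)"
    unfolding eq' using x by (simp add: powr_mult add.commute)
  finally show ?thesis .
qed

lemma incomplete_beta_tendsto_0:
  assumes "(f \<longlongrightarrow> 0) F" "eventually (\<lambda>x. f x \<ge> 0) F"
  shows "((\<lambda>x. incomplete_beta (f x)) \<longlongrightarrow> 0) F"
proof -
  have "2 + 0 \<notin> (\<real>\<^sub>\<le>\<^sub>0 :: complex set)" by (auto simp: complex_nonpos_Reals_iff)
  then obtain D where D: "(beta_kernel has_field_derivative D) (at 0)"
    by (rule beta_kernel_has_field_derivative)
  then have "isCont beta_kernel (of_real 0)" using DERIV_isCont by simp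
  then have "((\<lambda>x. beta_kernel (of_real (f x))) \<longlongrightarrow> beta_kernel (of_real 0)) F"
    using assms(1) by (intro isCont_tendsto_compose[of _ beta_kernel] tendsto_of_real)
  moreover have "((\<lambda>x. f x powr (2/5)) \<longlongrightarrow> 0 powr (2/5)) F"
    using assms by (intro tendsto_powr') (auto elim: eventually_mono)
  ultimately have "((\<lambda>x. incomplete_beta (f x)) \<longlongrightarrow> 5/2 * 0 powr (2/5) * Re (beta_kernel (of_real 0))) F"
    unfolding incomplete_beta_def by (intro tendsto_mult tendsto_const tendsto_Re)
  then show ?thesis by simp
qed

text \<open>The integrand is at most s^(-6/5), whose tail from x is 5 x^(-1/5). This is the Cauchy
  criterion at infinity; it avoids evaluating the limit there, which cancels later.\<close>

lemma incomplete_beta_diff_bounds: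
  assumes x: "0 < x" and xy: "x \<le> y"
  shows "incomplete_beta x \<le> incomplete_beta y" "incomplete_beta y - incomplete_beta x \<le> 5 * x powr (-1/5)"
proof -
  show "incomplete_beta x \<le> incomplete_beta y"
    using xy
  proof (rule DERIV_nonneg_imp_nondecreasing)
    fix s assume "x \<le> s" "s \<le> y"
    then show "\<exists>d. (incomplete_beta has_real_derivative d) (at s) \<and> 0 \<le> d"
      using x incomplete_beta_has_derivative[of s] by (intro exI[of _ "(s * (s + 2)) powr (-3/5)"]) auto
  qed
  have "- (incomplete_beta x + 5 * x powr (-1/5)) \<le> - (incomplete_beta y + 5 * y powr (-1/5))"
    using xy
  proof (rule DERIV_nonneg_imp_nondecreasing)
    fix s assume "x \<le> s" "s \<le> y"
    then have s: "s > 0" using x by simp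
    have "((\<lambda>s. - (incomplete_beta s + 5 * s powr (-1/5))) has_real_derivative
        s powr (-6/5) - (s * (s + 2)) powr (-3/5)) (at s)"
      using s by (auto intro!: derivative_eq_intros incomplete_beta_has_derivative)
    moreover have "(s * (s + 2)) powr (-3/5) \<le> (s * s) powr (-3/5)"
      using s by (intro powr_mono2') auto
    moreover have "(s * s) powr (-3/5) = s powr (-6/5)"
      using s by (simp add: powr_mult flip: powr_add)
    ultimately show "\<exists>d. ((\<lambda>s. - (incomplete_beta s + 5 * s powr (-1/5))) has_real_derivative d) (at s) \<and> 0 \<le> d"
      by (intro exI conjI) auto
  qed
  moreover have "5 * y powr (-1/5) \<ge> 0" by simp
  ultimately show "incomplete_beta y - incomplete_beta x \<le> 5 * x powr (-1/5)" by linarith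
qed

lemma incomplete_beta_diff_tendsto_0:
  assumes f: "filterlim f at_top F" and g: "filterlim g at_top F"
  shows "((\<lambda>x. incomplete_beta (f x) - incomplete_beta (g x)) \<longlongrightarrow> 0) F"
proof (rule Lim_null_comparison)
  have "eventually (\<lambda>x. f x > 0) F" "eventually (\<lambda>x. g x > 0) F"
    using f g by (auto simp: filterlim_at_top_dense)
  then show "eventually (\<lambda>x. norm (incomplete_beta (f x) - incomplete_beta (g x))
      \<le> 5 * f x powr (-1/5) + 5 * g x powr (-1/5)) F"
  proof eventually_elim
    case (elim x)
    have "5 * f x powr (-1/5) \<ge> 0" "5 * g x powr (-1/5) \<ge> 0" by simp_all
    with elim show ?case
      using incomplete_beta_diff_bounds[of "f x" "g x"] incomplete_beta_diff_bounds[of "g x" "f x"]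
      unfolding real_norm_def by linarith
  qed
  have "((\<lambda>x. 5 * f x powr (-1/5) + 5 * g x powr (-1/5)) \<longlongrightarrow> 5 * 0 + 5 * 0) F"
    using f g by (intro tendsto_intros tendsto_neg_powr) auto
  then show "((\<lambda>x. 5 * f x powr (-1/5) + 5 * g x powr (-1/5)) \<longlongrightarrow> 0) F" by simp
qed

section \<open>The primitive outside the interval from -2 to 2\<close>

text \<open>The polynomial P of the overview. The quadratic factor has discriminant 45/4 - 12 < 0,
  so -sqrt 5 / 2 is the only real root.\<close>

definition cubic :: "real \<Rightarrow> real" where
  "cubic t = (t + sqrt 5 / 2) * (t\<^sup>2 - 3 * (sqrt 5 / 2) * t + 3)"

text \<open>\<open>1 + quartic \<xi>\<close> is the polynomial whose square minus \<open>1\<close> is \<open>\<xi> ^ 5 * cubic (\<xi> + 1/\<xi>)\<close>.\<close>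

definition quartic :: "'a::real_normed_field \<Rightarrow> 'a" where
  "quartic \<xi> = \<xi> ^ 4 - of_real (sqrt 5 / 2) * \<xi> ^ 3 + \<xi>\<^sup>2 / 2"

text \<open>With r = sqrt 5 / 2, both s - 1 and s + 1 factor: s - 1 = x^2 (x^2 - r x + 1/2) and s +
  1 = (x^2 + r x + 1)(x^2 - 2 r x + 2). The factor x^2 + r x + 1 is self-reciprocal and the other
  two quadratics are reciprocal to each other up to a factor 2, so apart from x^5 the product
  depends on x + 1/x alone. Writing \<eta> for 1/x keeps all steps polynomial.\<close>

lemma quartic_cubic:
  assumes "\<xi> * \<eta> = 1"
  shows "quartic \<xi> * (quartic \<xi> + 2) = \<xi> ^ 5 * cubic (\<xi> + \<eta>)"
proof -
  define r where "r = sqrt 5 / 2"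
  have r: "r\<^sup>2 = 5/4" by (simp add: r_def power_divide)
  have 1: "quartic \<xi> = \<xi>\<^sup>2 * (\<xi>\<^sup>2 - r * \<xi> + 1/2)"
    unfolding quartic_def r_def[symmetric] of_real_eq_id id_apply
    by (simp add: algebra_simps power2_eq_square power3_eq_cube power4_eq_xxxx)
  have 2: "quartic \<xi> + 2 = (\<xi>\<^sup>2 + r * \<xi> + 1) * (\<xi>\<^sup>2 - 2 * r * \<xi> + 2)"
    unfolding 1 using r by algebra
  have 3: "\<xi>\<^sup>2 + r * \<xi> + 1 = \<xi> * (\<xi> + \<eta> + r)"
    using assms by algebra
  have 4: "(\<xi>\<^sup>2 - r * \<xi> + 1/2) * (\<xi>\<^sup>2 - 2 * r * \<xi> + 2) = \<xi>\<^sup>2 * ((\<xi> + \<eta>)\<^sup>2 - 3 * r * (\<xi> + \<eta>) + 3)"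
  proof -
    have "\<xi>\<^sup>2 * ((\<xi> + \<eta>)\<^sup>2 - 3 * r * (\<xi> + \<eta>) + 3)
        = (\<xi>\<^sup>2 + \<xi> * \<eta>)\<^sup>2 - 3 * r * \<xi> * (\<xi>\<^sup>2 + \<xi> * \<eta>) + 3 * \<xi>\<^sup>2" by algebra
    also have "\<dots> = \<xi> ^ 4 - 3 * r * \<xi> ^ 3 + 5 * \<xi>\<^sup>2 - 3 * r * \<xi> + 1"
      unfolding assms by algebra
    also have "\<dots> = (\<xi>\<^sup>2 - r * \<xi> + 1/2) * (\<xi>\<^sup>2 - 2 * r * \<xi> + 2)"
      using r by algebra
    finally show ?thesis ..
  qed
  have "quartic \<xi> * (quartic \<xi> + 2)
      = \<xi>\<^sup>2 * (\<xi> * (\<xi> + \<eta> + r)) * ((\<xi>\<^sup>2 - r * \<xi> + 1/2) * (\<xi>\<^sup>2 - 2 * r * \<xi> + 2))"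
    unfolding 2 unfolding 1 3 by algebra
  also have "\<dots> = \<xi> ^ 5 * cubic (\<xi> + \<eta>)"
    unfolding 4 cubic_def r_def[symmetric] by algebra
  finally show ?thesis .
qed

lemma quartic_pos:
  fixes \<xi> :: real
  assumes "\<xi> \<noteq> 0" shows "quartic \<xi> > 0"
proof -
  define r where "r = sqrt 5 / 2"
  have r: "r\<^sup>2 = 5/4" by (simp add: r_def power_divide)
  have "quartic \<xi> = \<xi>\<^sup>2 * ((\<xi> - r/2)\<^sup>2 + 3/16)"
    unfolding quartic_def r_def[symmetric] of_real_eq_id id_apply using r by algebra
  moreover have "(\<xi> - r/2)\<^sup>2 + 3/16 > 0" by (simp add: add_nonneg_pos)
  ultimately show ?thesis using assms by simp
qed

definition outer_antideriv :: "real \<Rightarrow> real" where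
  "outer_antideriv t = (incomplete_beta (quartic ((t + sqrt (t\<^sup>2 - 4)) / 2))
                       + incomplete_beta (quartic ((t - sqrt (t\<^sup>2 - 4)) / 2))) / 3"

text \<open>Let y = 1/x. The factor x^5 contributes |x|^(-3) = sgn t y^3, which turns s'(x) into 4 -
  3 r y + y^2 with r = sqrt 5 / 2. Multiplied by dx/dt, that is by x/(x - y), this gives (4 x - 3 r
  + y)/(x - y); on adding the same term with x and y exchanged, r cancels and the constant 3 is
  left.\<close>

lemma outer_antideriv_has_derivative:
  assumes t: "\<bar>t\<bar> > 2"
  shows "(outer_antideriv has_real_derivative sgn t * \<bar>cubic t\<bar> powr (-3/5)) (at t)"
proof -
  define d where "d = sqrt (t\<^sup>2 - 4)"
  have t4: "t\<^sup>2 - 4 > 0" using power_strict_mono[of 2 "\<bar>t\<bar>" 2] t by simp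
  then have d: "d > 0" "d\<^sup>2 = t\<^sup>2 - 4" by (simp_all add: d_def)
  define \<xi> \<eta> where "\<xi> = (t + d) / 2" and "\<eta> = (t - d) / 2"
  have prod: "\<xi> * \<eta> = 1" "\<eta> * \<xi> = 1"
    using d(2) by (simp_all add: \<xi>_def \<eta>_def power2_eq_square algebra_simps)
  then have nz: "\<xi> \<noteq> 0" "\<eta> \<noteq> 0" by auto
  have sum: "\<xi> + \<eta> = t" "\<eta> + \<xi> = t" by (simp_all add: \<xi>_def \<eta>_def field_simps)
  have "sgn x = sgn (x + y)" if "x * y = 1" for x y :: real
  proof (cases "x > 0")
    case True
    then have "y > 0" using that zero_less_mult_pos[of x y] by simp
    with True show ?thesis by simp
  next
    case False
    with that have x: "x < 0" by (cases "x = 0") auto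
    then have "y < 0" using that zero_less_mult_pos[of "-x" "-y"] by simp
    with x show ?thesis by simp
  qed
  from this[OF prod(1)] this[OF prod(2)] have sg: "sgn \<xi> = sgn t" "sgn \<eta> = sgn t"
    by (simp_all add: sum)
  have "((\<lambda>t. sqrt (t\<^sup>2 - 4)) has_real_derivative inverse (sqrt (t\<^sup>2 - 4)) / 2 * (2 * t)) (at t)"
    by (rule DERIV_chain2[where f = sqrt and g = "\<lambda>t. t\<^sup>2 - 4" and x = t, OF DERIV_real_sqrt[OF t4]]) (auto intro!: derivative_eq_intros)
  then have dd: "((\<lambda>t. sqrt (t\<^sup>2 - 4)) has_real_derivative t / d) (at t)"
    by (simp add: d_def field_simps)
  have dx: "((\<lambda>t. (t + sqrt (t\<^sup>2 - 4)) / 2) has_real_derivative \<xi> / d) (at t)"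
    using DERIV_cdivide[OF DERIV_add[OF DERIV_ident dd], of 2] d
    by (simp add: \<xi>_def add_divide_distrib mult.commute add.commute)
  have dy: "((\<lambda>t. (t - sqrt (t\<^sup>2 - 4)) / 2) has_real_derivative - \<eta> / d) (at t)"
    using DERIV_cdivide[OF DERIV_diff[OF DERIV_ident dd], of 2] d
    by (simp add: \<eta>_def diff_divide_distrib mult.commute)
  \<comment> \<open>Stated for an arbitrary reciprocal pair so that it serves both summands, with
    the roles of \<xi> and \<eta> exchanged.\<close>
  have main: "((\<lambda>t. incomplete_beta (quartic t)) has_real_derivative
      sgn t * \<bar>cubic t\<bar> powr (-3/5) * (4 - 3 * (sqrt 5 / 2) * y + y\<^sup>2)) (at x)"
    if "x * y = 1" "x + y = t" "sgn x = sgn t" for x y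
  proof -
    have x: "x \<noteq> 0" using that by auto
    have q: "(quartic has_real_derivative (4 * x ^ 3 - 3 * (sqrt 5 / 2) * x\<^sup>2 + x)) (at x)"
      unfolding quartic_def[abs_def] by (auto intro!: derivative_eq_intros simp: power2_eq_square)
    have "((\<lambda>t. incomplete_beta (quartic t)) has_real_derivative
        (quartic x * (quartic x + 2)) powr (-3/5) * (4 * x ^ 3 - 3 * (sqrt 5 / 2) * x\<^sup>2 + x)) (at x)"
      by (rule DERIV_chain2[OF incomplete_beta_has_derivative q]) (rule quartic_pos[OF x])
    also have "quartic x * (quartic x + 2) = x ^ 5 * cubic t"
      using quartic_cubic[OF that(1)] that by simp
    also have "x ^ 5 * cubic t = \<bar>x\<bar> ^ 5 * \<bar>cubic t\<bar>"
    proof -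
      have "x ^ 5 * cubic t > 0"
        using quartic_pos[OF x] quartic_cubic[OF that(1)] that(2) by (metis add_pos_pos mult_pos_pos zero_less_numeral)
      then show ?thesis by (metis abs_mult abs_of_pos power_abs)
    qed
    also have "(\<bar>x\<bar> ^ 5 * \<bar>cubic t\<bar>) powr (-3/5) = \<bar>x\<bar> powr (-3) * \<bar>cubic t\<bar> powr (-3/5)"
    proof -
      have "\<bar>x\<bar> ^ 5 = \<bar>x\<bar> powr 5" using x by (simp add: powr_numeral)
      then show ?thesis by (simp only: powr_mult powr_powr) simp
    qed
    also have "\<bar>x\<bar> powr (-3) = 1 / \<bar>x\<bar> ^ 3"
      using x by (simp add: powr_minus powr_numeral divide_inverse)
    also have "1 / \<bar>x\<bar> ^ 3 = sgn t * y ^ 3"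
    proof -
      have "\<bar>x\<bar> * (sgn t * y) = 1"
        using that abs_mult_sgn[of x] by (simp flip: mult.assoc)
      then have "\<bar>x\<bar> ^ 3 * (sgn t * y) ^ 3 = 1"
        by (metis power_mult_distrib power_one)
      moreover have "sgn t ^ 3 = sgn t" by (simp add: sgn_if)
      ultimately show ?thesis using x by (simp add: power_mult_distrib field_simps)
    qed
    also have "sgn t * y ^ 3 * \<bar>cubic t\<bar> powr (-3/5) * (4 * x ^ 3 - 3 * (sqrt 5 / 2) * x\<^sup>2 + x)
       = sgn t * \<bar>cubic t\<bar> powr (-3/5) * (4 - 3 * (sqrt 5 / 2) * y + y\<^sup>2)"
    proof -
      have "y ^ 3 * (4 * x ^ 3 - 3 * (sqrt 5 / 2) * x\<^sup>2 + x) = 4 - 3 * (sqrt 5 / 2) * y + y\<^sup>2"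
        using that(1) by algebra
      then show ?thesis by (simp add: mult_ac)
    qed
    finally show ?thesis .
  qed
  have "((\<lambda>t. incomplete_beta (quartic ((t + sqrt (t\<^sup>2 - 4)) / 2))) has_real_derivative
      sgn t * \<bar>cubic t\<bar> powr (-3/5) * (4 - 3 * (sqrt 5 / 2) * \<eta> + \<eta>\<^sup>2) * (\<xi> / d)) (at t)"
    by (rule DERIV_chain2[of "\<lambda>t. incomplete_beta (quartic t)", OF _ dx])
       (use main[OF prod(1) sum(1) sg(1)] in \<open>simp add: \<xi>_def d_def\<close>)
  moreover have "((\<lambda>t. incomplete_beta (quartic ((t - sqrt (t\<^sup>2 - 4)) / 2))) has_real_derivative
      sgn t * \<bar>cubic t\<bar> powr (-3/5) * (4 - 3 * (sqrt 5 / 2) * \<xi> + \<xi>\<^sup>2) * (- \<eta> / d)) (at t)"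
    by (rule DERIV_chain2[of "\<lambda>t. incomplete_beta (quartic t)", OF _ dy])
       (use main[OF prod(2) sum(2) sg(2)] in \<open>simp add: \<eta>_def d_def\<close>)
  ultimately have "(outer_antideriv has_real_derivative
     (sgn t * \<bar>cubic t\<bar> powr (-3/5) * (4 - 3 * (sqrt 5 / 2) * \<eta> + \<eta>\<^sup>2) * (\<xi> / d)
      + sgn t * \<bar>cubic t\<bar> powr (-3/5) * (4 - 3 * (sqrt 5 / 2) * \<xi> + \<xi>\<^sup>2) * (- \<eta> / d)) / 3) (at t)"
    unfolding outer_antideriv_def[abs_def] by (intro DERIV_cdivide DERIV_add)
  moreover have "(4 - 3 * (sqrt 5 / 2) * \<eta> + \<eta>\<^sup>2) * \<xi> - (4 - 3 * (sqrt 5 / 2) * \<xi> + \<xi>\<^sup>2) * \<eta> = 3 * d"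
  proof -
    have "\<xi> - \<eta> = d" by (simp add: \<xi>_def \<eta>_def field_simps)
    with prod(1) show ?thesis by algebra
  qed
  then have "(sgn t * \<bar>cubic t\<bar> powr (-3/5) * (4 - 3 * (sqrt 5 / 2) * \<eta> + \<eta>\<^sup>2) * (\<xi> / d)
      + sgn t * \<bar>cubic t\<bar> powr (-3/5) * (4 - 3 * (sqrt 5 / 2) * \<xi> + \<xi>\<^sup>2) * (- \<eta> / d)) / 3
      = sgn t * \<bar>cubic t\<bar> powr (-3/5)"
  proof -
    assume a: "(4 - 3 * (sqrt 5 / 2) * \<eta> + \<eta>\<^sup>2) * \<xi> - (4 - 3 * (sqrt 5 / 2) * \<xi> + \<xi>\<^sup>2) * \<eta> = 3 * d"
    define K where "K = sgn t * \<bar>cubic t\<bar> powr (-3/5)"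
    define u v where "u = 4 - 3 * (sqrt 5 / 2) * \<eta> + \<eta>\<^sup>2" and "v = 4 - 3 * (sqrt 5 / 2) * \<xi> + \<xi>\<^sup>2"
    have "(K * u * (\<xi> / d) + K * v * (- \<eta> / d)) / 3 = K * (u * \<xi> - v * \<eta>) / (3 * d)"
      using d by (simp add: field_simps)
    also have "u * \<xi> - v * \<eta> = 3 * d" using a by (simp add: u_def v_def)
    finally show ?thesis using d by (simp add: K_def u_def v_def)
  qed
  ultimately show ?thesis by simp
qed

section \<open>The primitive along the unit circle\<close>

lemma powr_polar:
  assumes "\<rho> > 0" "-pi < \<phi>" "\<phi> \<le> pi"
  shows "(of_real \<rho> * cis \<phi>) powr (of_real a) = of_real (\<rho> powr a) * cis (a * \<phi>)"
proof -
  have "of_real \<rho> * cis \<phi> = exp (Complex (ln \<rho>) \<phi>)"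
    using assms by (simp add: exp_eq_polar exp_ln)
  moreover have "Ln (exp (Complex (ln \<rho>) \<phi>)) = Complex (ln \<rho>) \<phi>"
    using assms by (intro Ln_exp) auto
  ultimately have "(of_real \<rho> * cis \<phi>) powr (of_real a) = exp (of_real a * Complex (ln \<rho>) \<phi>)"
    by (simp add: powr_def)
  also have "of_real a * Complex (ln \<rho>) \<phi> = Complex (a * ln \<rho>) (a * \<phi>)"
    by (simp add: complex_eq_iff)
  also have "exp \<dots> = of_real (\<rho> powr a) * cis (a * \<phi>)"
    using assms by (simp add: exp_eq_polar powr_def)
  finally show ?thesis .
qed

lemma polar_notin_nonpos_Reals:
  assumes "\<rho> > 0" "-pi < \<phi>" "\<phi> < pi"
  shows "of_real \<rho> * cis \<phi> \<notin> \<real>\<^sub>\<le>\<^sub>0"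
proof
  assume "of_real \<rho> * cis \<phi> \<in> \<real>\<^sub>\<le>\<^sub>0"
  then have "\<rho> * sin \<phi> = 0" "\<rho> * cos \<phi> \<le> 0"
    by (auto simp: complex_nonpos_Reals_iff)
  then have "\<phi> = 0" "cos \<phi> \<le> 0"
    using assms sin_eq_0_pi[of \<phi>] by (auto simp: mult_le_0_iff)
  then show False by simp
qed

definition arc_factor :: "complex \<Rightarrow> complex" where
  "arc_factor w = 1 - of_real (sqrt 5 / 2) * exp (- \<i> * w) + exp (- 2 * \<i> * w) / 2"

text \<open>
  With \<open>\<xi> = cis w\<close> we have \<open>quartic \<xi> = \<xi> ^ 4 * arc_factor w\<close>. Since \<open>arc_factor\<close> has positive real
  part, its principal power is the continuous branch of the power of \<open>quartic\<close> along the arc,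
  although the argument of \<open>quartic\<close> itself runs from \<open>0\<close> to \<open>4 * pi\<close>.
\<close>

definition arc_primitive :: "complex \<Rightarrow> complex" where
  "arc_primitive w = 5/2 * exp (8/5 * \<i> * w) * arc_factor w powr (2/5)
                     * beta_kernel (exp (4 * \<i> * w) * arc_factor w)"

lemma arc_factor_cis:
  "arc_factor (of_real \<theta>) = 1 - of_real (sqrt 5 / 2) * cis (-\<theta>) + cis (-\<theta>) ^ 2 / 2"
  by (simp add: arc_factor_def cis_conv_exp power2_eq_square algebra_simps flip: exp_add)

lemma arc_factor_Re_Im:
  "Re (arc_factor (of_real \<theta>)) = (cos \<theta>)\<^sup>2 - sqrt 5 / 2 * cos \<theta> + 1/2"
  "Im (arc_factor (of_real \<theta>)) = sin \<theta> * (sqrt 5 / 2 - cos \<theta>)"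
proof -
  have "(sin \<theta>)\<^sup>2 = 1 - (cos \<theta>)\<^sup>2" by (rule sin_squared_eq)
  moreover have "Re (cis (-\<theta>) ^ 2) = (cos \<theta>)\<^sup>2 - (sin \<theta>)\<^sup>2"
    by (simp add: power2_eq_square)
  ultimately show "Re (arc_factor (of_real \<theta>)) = (cos \<theta>)\<^sup>2 - sqrt 5 / 2 * cos \<theta> + 1/2"
    by (simp add: arc_factor_cis diff_divide_distrib)
  show "Im (arc_factor (of_real \<theta>)) = sin \<theta> * (sqrt 5 / 2 - cos \<theta>)"
    by (simp add: arc_factor_cis power2_eq_square algebra_simps)
qed

lemma sqrt_5_half: "sqrt 5 / 2 > 1" "sqrt 5 / 2 < 6/5"
proof -
  show "sqrt 5 / 2 > 1" using real_less_rsqrt[of 2 5] by simp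
  show "sqrt 5 / 2 < 6/5" using real_less_lsqrt[of "12/5" 5] by (simp add: power2_eq_square)
qed

lemma arc_factor_Re_pos: "Re (arc_factor (of_real \<theta>)) > 0"
proof -
  define r where "r = sqrt 5 / 2"
  have r: "r\<^sup>2 = 5/4" by (simp add: r_def power_divide)
  have "(cos \<theta>)\<^sup>2 - r * cos \<theta> + 1/2 = (cos \<theta> - r/2)\<^sup>2 + 3/16"
    using r by algebra
  moreover have "(cos \<theta> - r/2)\<^sup>2 + 3/16 > 0" by (simp add: add_nonneg_pos)
  ultimately show ?thesis by (simp add: arc_factor_Re_Im r_def)
qed

text \<open>On the unit circle the two mutually reciprocal quadratics become, up to elementary
  factors, \<open>arc_factor\<close> and its conjugate, so the quadratic factor of
  \<open>cubic\<close> is twice a squared modulus.\<close>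

lemma arc_factor_norm:
  "cubic (2 * cos \<theta>) = 2 * (2 * cos \<theta> + sqrt 5 / 2) * (norm (arc_factor (of_real \<theta>)))\<^sup>2"
proof -
  define r where "r = sqrt 5 / 2"
  have r: "r\<^sup>2 = 5/4" by (simp add: r_def power_divide)
  define c s where "c = cos \<theta>" and "s = sin \<theta>"
  have cs: "s\<^sup>2 = 1 - c\<^sup>2" by (simp add: c_def s_def sin_squared_eq)
  have "(norm (arc_factor (of_real \<theta>)))\<^sup>2 = (c\<^sup>2 - r * c + 1/2)\<^sup>2 + (s * (r - c))\<^sup>2"
    by (simp add: cmod_power2 arc_factor_Re_Im r_def c_def s_def)
  also have "\<dots> = 2 * c\<^sup>2 - 3 * r * c + 3/2"
    using r cs by algebra
  finally have n: "(norm (arc_factor (of_real \<theta>)))\<^sup>2 = 2 * c\<^sup>2 - 3 * r * c + 3/2" .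
  show ?thesis
    unfolding n cubic_def by (simp add: r_def c_def algebra_simps power2_eq_square)
qed

text \<open>The factorization of s + 1 on the unit circle: x^2 + r x + 1 = x (2 cos \<theta> + r),
  and the other quadratic is twice the conjugate of \<open>arc_factor\<close>. The phase of s + 1 is
  thus explicit, and s = -1 exactly at the root of \<open>cubic\<close>.\<close>

lemma two_plus_arc_value:
  "2 + cis \<theta> ^ 4 * arc_factor (of_real \<theta>)
     = of_real (2 * (2 * cos \<theta> + sqrt 5 / 2)) * cis \<theta> * cnj (arc_factor (of_real \<theta>))"
proof -
  define r :: complex where "r = of_real (sqrt 5 / 2)"
  have r: "r\<^sup>2 = 5/4" by (simp add: r_def power_divide flip: of_real_power)
  define x y where "x = cis \<theta>" and "y = cis (-\<theta>)"
  have xy: "x * y = 1" by (simp add: x_def y_def cis_mult)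
  have c: "of_real (2 * (2 * cos \<theta> + sqrt 5 / 2)) = 2 * (x + y + r)"
    by (simp add: complex_eq_iff x_def y_def r_def)
  have n: "arc_factor (of_real \<theta>) = 1 - r * y + y\<^sup>2 / 2"
    by (simp add: arc_factor_cis r_def y_def)
  have n': "cnj (arc_factor (of_real \<theta>)) = 1 - r * x + x\<^sup>2 / 2"
    unfolding n by (simp add: r_def y_def x_def cis_cnj)
  have 1: "x ^ 4 * (1 - r * y + y\<^sup>2 / 2) = x ^ 4 - r * x ^ 3 + x\<^sup>2 / 2"
  proof -
    have "x ^ 4 * (1 - r * y + y\<^sup>2 / 2) = x ^ 4 - r * x ^ 3 * (x * y) + x\<^sup>2 * (x * y)\<^sup>2 / 2"
      by (simp add: field_simps power2_eq_square power3_eq_cube power4_eq_xxxx)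
    then show ?thesis by (simp add: xy)
  qed
  have 2: "2 * (x + y + r) * x = 2 * (x\<^sup>2 + r * x + 1)"
    using xy by algebra
  have "2 + (x ^ 4 - r * x ^ 3 + x\<^sup>2 / 2) = 2 * (x\<^sup>2 + r * x + 1) * (1 - r * x + x\<^sup>2 / 2)"
  proof -
    have "2 * (x\<^sup>2 + r * x + 1) * (1 - r * x + x\<^sup>2 / 2) = x ^ 4 - r * x ^ 3 + (3 - 2 * r\<^sup>2) * x\<^sup>2 + 2"
      by (simp add: field_simps power2_eq_square power3_eq_cube power4_eq_xxxx)
    then show ?thesis by (simp add: r)
  qed
  then show ?thesis
    unfolding c n' x_def[symmetric] 2 unfolding n 1 .
qed

text \<open>A count of phases. Let \<phi> be the argument of \<open>arc_factor\<close>. The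
  exponential and the factor cis(-\<theta>) contribute 3/5 \<theta>, the power of
  \<open>arc_factor\<close> contributes -3/5 \<phi>, and the power of s + 1 contributes -3/5
  (\<theta> - \<phi>): the sum is 0. Beyond the root the real factor of s + 1 is negative, its
  principal argument drops by pi, and the constant phase 3/5 pi remains.\<close>

lemma arc_primitive_has_vector_derivative:
  assumes \<theta>: "0 \<le> \<theta>" "\<theta> \<le> pi" and ne: "2 * cos \<theta> + sqrt 5 / 2 \<noteq> 0"
  defines "\<epsilon> \<equiv> if 2 * cos \<theta> + sqrt 5 / 2 > 0 then 1 else cis (3/5 * pi)"
  shows "((\<lambda>\<theta>. arc_primitive (of_real \<theta>)) has_vector_derivative
     \<i> * (4 * cis \<theta> - 3 * of_real (sqrt 5 / 2) + cis (-\<theta>)) * \<epsilon> * of_real (\<bar>cubic (2 * cos \<theta>)\<bar> powr (-3/5))) (at \<theta>)"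
proof -
  define r :: complex where "r = of_real (sqrt 5 / 2)"
  define n where "n = arc_factor (of_real \<theta>)"
  define x y where "x = cis \<theta>" and "y = cis (-\<theta>)"
  have xy: "x * y = 1" by (simp add: x_def y_def cis_mult)
  have ny: "n = 1 - r * y + y\<^sup>2 / 2"
    by (simp add: n_def arc_factor_cis r_def y_def)
  have Re: "Re n > 0" by (simp add: n_def arc_factor_Re_pos)
  have Im: "Im n \<ge> 0"
  proof -
    have "sqrt 5 / 2 - cos \<theta> \<ge> 0" using sqrt_5_half(1) cos_le_one[of \<theta>] by linarith
    moreover have "sin \<theta> \<ge> 0" using \<theta> by (rule sin_ge_zero)
    ultimately show ?thesis by (simp add: n_def arc_factor_Re_Im)
  qed
  have nz: "n \<noteq> 0" using Re by auto
  define \<rho> \<phi> where "\<rho> = norm n" and "\<phi> = Im (Ln n)"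
  have \<rho>: "\<rho> > 0" using nz by (simp add: \<rho>_def)
  have \<phi>: "0 \<le> \<phi>" "\<phi> < pi / 2"
    using Im_Ln_pos_le[OF nz] Re_Ln_pos_lt[OF nz] Re Im by (auto simp: \<phi>_def)
  have polar: "n = of_real \<rho> * cis \<phi>"
  proof -
    have "n = exp (Ln n)" using nz by simp
    also have "\<dots> = of_real (exp (Re (Ln n))) * cis \<phi>"
      by (simp add: exp_eq_polar \<phi>_def)
    also have "exp (Re (Ln n)) = \<rho>" using nz by (simp add: \<rho>_def)
    finally show ?thesis .
  qed
  define z where "z = x ^ 4 * n"
  define a where "a = 2 * cos \<theta> + sqrt 5 / 2"
  have z2: "2 + z = of_real (2 * a * \<rho>) * cis (\<theta> - \<phi>)"
    using two_plus_arc_value[of \<theta>]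
    by (simp add: z_def x_def a_def n_def[symmetric] polar cis_cnj mult_ac flip: cis_mult)
      (simp add: cis_mult)
  \<comment> \<open>The principal argument of 2 + z; the shift by pi absorbs the sign of
    \<open>a\<close>.\<close>
  define \<psi> where "\<psi> = (if a > 0 then \<theta> - \<phi> else \<theta> - \<phi> - pi)"
  have z3: "2 + z = of_real (2 * \<bar>a\<bar> * \<rho>) * cis \<psi>"
  proof (cases "a > 0")
    case False
    have "cis \<psi> = - cis (\<theta> - \<phi>)" using False
      by (simp add: \<psi>_def complex_eq_iff)
    with False show ?thesis unfolding z2 by simp
  qed (simp add: z2 \<psi>_def)
  have \<psi>: "-pi < \<psi>" "\<psi> < pi"
  proof -
    have "-pi < \<psi> \<and> \<psi> < pi"
    proof (cases "a > 0")
      case True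
      \<comment> \<open>Equality would need \<theta> = pi and \<phi> = 0, but at \<theta> = pi the
        factor \<open>a\<close> is negative.\<close>
      have "\<theta> - \<phi> < pi"
      proof (cases "\<phi> = 0")
        case True
        then have "Im n = 0" by (simp add: polar)
        then have "sin \<theta> = 0" using sqrt_5_half(1) cos_le_one[of \<theta>] by (simp add: n_def arc_factor_Re_Im)
        moreover have "\<theta> \<noteq> pi" using \<open>a > 0\<close> sqrt_5_half(2) by (auto simp: a_def)
        ultimately have "\<theta> = 0" using \<theta> sin_gt_zero[of \<theta>] by force
        with True show ?thesis by simp
      qed (use \<theta> \<phi> in auto)
      with True \<theta> \<phi> show ?thesis by (auto simp: \<psi>_def)
    next
      case False
      have "\<theta> > pi / 2"
      proof (rule ccontr)
        assume "\<not> \<theta> > pi / 2"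
        then have "cos \<theta> \<ge> 0" using \<theta> by (intro cos_ge_zero) auto
        then show False using False sqrt_5_half(1) by (simp add: a_def)
      qed
      with False \<theta> \<phi> show ?thesis by (auto simp: \<psi>_def)
    qed
    then show "-pi < \<psi>" "\<psi> < pi" by auto
  qed
  have a0: "\<bar>a\<bar> > 0" using ne by (simp add: a_def)
  have n_nonpos: "n \<notin> \<real>\<^sub>\<le>\<^sub>0" using Re by (auto simp: complex_nonpos_Reals_iff)
  have z_nonpos: "2 + z \<notin> \<real>\<^sub>\<le>\<^sub>0"
    unfolding z3 using a0 \<rho> \<psi> by (intro polar_notin_nonpos_Reals) auto
  then obtain D where D: "(beta_kernel has_field_derivative D) (at z)"
    and eq: "beta_kernel z + 5/2 * z * D = (2 + z) powr (-3/5)"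
    by (rule beta_kernel_has_field_derivative)
  define n' where "n' = \<i> * r * y - \<i> * y\<^sup>2"
  have ey: "exp (- \<i> * of_real \<theta>) = y" "exp (- 2 * \<i> * of_real \<theta>) = y\<^sup>2" "exp (4 * \<i> * of_real \<theta>) = x ^ 4"
    by (simp_all add: y_def x_def cis_conv_exp power2_eq_square power4_eq_xxxx mult.assoc flip: exp_add)
  have dn: "(arc_factor has_field_derivative n') (at (of_real \<theta>))"
  proof -
    have "((\<lambda>w. exp (- \<i> * w)) has_field_derivative exp (- \<i> * of_real \<theta>) * - \<i>) (at (of_real \<theta>))"
      and "((\<lambda>w. exp (- 2 * \<i> * w)) has_field_derivative exp (- 2 * \<i> * of_real \<theta>) * (- 2 * \<i>)) (at (of_real \<theta>))"
      by (auto intro!: derivative_eq_intros)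
    note d = this[unfolded ey]
    have "(arc_factor has_field_derivative 0 - r * (y * - \<i>) + y\<^sup>2 * (- 2 * \<i>) / 2) (at (of_real \<theta>))"
      unfolding arc_factor_def[abs_def] r_def
      by (intro DERIV_add DERIV_diff DERIV_const DERIV_cdivide DERIV_cmult d)
    then show ?thesis by (simp add: n'_def algebra_simps)
  qed
  have dz: "((\<lambda>w. exp (4 * \<i> * w) * arc_factor w) has_field_derivative x ^ 4 * (4 * \<i> * n + n')) (at (of_real \<theta>))"
  proof -
    have "((\<lambda>w. exp (4 * \<i> * w)) has_field_derivative exp (4 * \<i> * of_real \<theta>) * (4 * \<i>)) (at (of_real \<theta>))"
      by (auto intro!: derivative_eq_intros)
    from DERIV_mult[OF this dn, unfolded ey, folded n_def] show ?thesis
      by (simp add: algebra_simps)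
  qed
  have db: "((\<lambda>w. beta_kernel (exp (4 * \<i> * w) * arc_factor w)) has_field_derivative
      D * (x ^ 4 * (4 * \<i> * n + n'))) (at (of_real \<theta>))"
    by (rule DERIV_chain2[OF _ dz]) (use D in \<open>simp only: ey z_def n_def\<close>)
  have dp: "((\<lambda>w. arc_factor w powr (2/5)) has_field_derivative (2/5 * n powr (-3/5) * n')) (at (of_real \<theta>))"
    by (rule DERIV_chain2[OF _ dn])
      (use n_nonpos in \<open>auto intro!: derivative_eq_intros simp: n_def[symmetric]\<close>)
  define e where "e = exp (8/5 * \<i> * of_real \<theta>)"
  have de: "((\<lambda>w. 5/2 * exp (8/5 * \<i> * w)) has_field_derivative (4 * \<i> * e)) (at (of_real \<theta>))"
    by (auto intro!: derivative_eq_intros simp: e_def)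
  have np: "n powr (2/5) = n * n powr (-3/5)"
  proof -
    have "n powr (2/5) = n powr (1 + (-3/5))" by simp
    also have "\<dots> = n powr 1 * n powr (-3/5)" by (simp only: powr_add)
    finally show ?thesis using nz by simp
  qed
  have "(arc_primitive has_field_derivative
      (4 * \<i> * e * n powr (2/5) + 2/5 * n powr (-3/5) * n' * (5/2 * e)) * beta_kernel z
      + D * (x ^ 4 * (4 * \<i> * n + n')) * (5/2 * e * n powr (2/5))) (at (of_real \<theta>))"
    using DERIV_mult[OF DERIV_mult[OF de dp] db]
    by (simp only: arc_primitive_def[abs_def] ey z_def n_def e_def)
  also have "(4 * \<i> * e * n powr (2/5) + 2/5 * n powr (-3/5) * n' * (5/2 * e)) * beta_kernel z
      + D * (x ^ 4 * (4 * \<i> * n + n')) * (5/2 * e * n powr (2/5))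
      = e * n powr (-3/5) * (4 * \<i> * n + n') * (beta_kernel z + 5/2 * z * D)"
    unfolding np z_def by (simp add: algebra_simps)
  \<comment> \<open>This is i x s'(x) divided by x^4, the derivative of s along the circle in terms
    of \<open>arc_factor\<close>.\<close>
  also have "4 * \<i> * n + n' = \<i> * (4 * x - 3 * r + y) * y"
  proof -
    have "4 * \<i> * n + n' = \<i> * (4 - 3 * r * y + y\<^sup>2)"
      unfolding ny n'_def by (simp add: algebra_simps)
    also have "4 - 3 * r * y + y\<^sup>2 = (4 * x - 3 * r + y) * y"
      using xy by algebra
    finally show ?thesis by simp
  qed
  also have "e * n powr (-3/5) * (\<i> * (4 * x - 3 * r + y) * y) * (beta_kernel z + 5/2 * z * D)
     = \<i> * (4 * x - 3 * r + y) * (e * y * n powr (-3/5) * (2 + z) powr (-3/5))"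
    unfolding eq by (simp add: mult_ac)
  also have "e * y * n powr (-3/5) * (2 + z) powr (-3/5) = \<epsilon> * of_real (\<bar>cubic (2 * cos \<theta>)\<bar> powr (-3/5))"
  proof -
    have m: "(-3/5 :: complex) = of_real (-3/5)" by simp
    have "e * y = cis (3/5 * \<theta>)"
      by (simp add: e_def y_def cis_conv_exp algebra_simps flip: exp_add)
    moreover have "n powr (-3/5) = of_real (\<rho> powr (-3/5)) * cis (-3/5 * \<phi>)"
      unfolding polar m using \<rho> \<phi> by (intro powr_polar) auto
    moreover have "(2 + z) powr (-3/5) = of_real ((2 * \<bar>a\<bar> * \<rho>) powr (-3/5)) * cis (-3/5 * \<psi>)"
      unfolding z3 m using a0 \<rho> \<psi> by (intro powr_polar) auto
    ultimately have "e * y * n powr (-3/5) * (2 + z) powr (-3/5)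
        = of_real (\<rho> powr (-3/5) * (2 * \<bar>a\<bar> * \<rho>) powr (-3/5))
          * (cis (3/5 * \<theta>) * cis (-3/5 * \<phi>) * cis (-3/5 * \<psi>))"
      by (simp add: mult_ac)
    also have "cis (3/5 * \<theta>) * cis (-3/5 * \<phi>) * cis (-3/5 * \<psi>) = \<epsilon>"
    proof -
      have "3/5 * \<theta> + -3/5 * \<phi> + -3/5 * \<psi> = (if a > 0 then 0 else 3/5 * pi)"
        by (simp add: \<psi>_def field_simps)
      then show ?thesis by (simp only: cis_mult) (simp add: \<epsilon>_def a_def)
    qed
    also have "\<rho> powr (-3/5) * (2 * \<bar>a\<bar> * \<rho>) powr (-3/5) = (\<rho> * (2 * \<bar>a\<bar> * \<rho>)) powr (-3/5)"
      by (simp only: powr_mult)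
    also have "\<rho> * (2 * \<bar>a\<bar> * \<rho>) = \<bar>cubic (2 * cos \<theta>)\<bar>"
      unfolding arc_factor_norm a_def[symmetric] n_def[symmetric] \<rho>_def[symmetric]
      using \<rho> by (simp add: abs_mult power2_eq_square)
    finally show ?thesis by (simp add: mult_ac)
  qed
  finally have "(arc_primitive has_field_derivative
      \<i> * (4 * x - 3 * r + y) * (\<epsilon> * of_real (\<bar>cubic (2 * cos \<theta>)\<bar> powr (-3/5)))) (at (of_real \<theta>))" .
  then show ?thesis
    using has_vector_derivative_real_field[of arc_primitive _ \<theta> UNIV]
    by (simp add: x_def y_def r_def mult.assoc)
qed

lemma arc_primitive_0: "Re (arc_primitive (of_real 0)) = incomplete_beta (quartic 1)"
proof -
  have q: "arc_factor (of_real 0) = of_real (quartic 1)"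
    by (simp add: arc_factor_def quartic_def)
  have "(of_real (quartic 1) :: complex) powr (2/5) = of_real (quartic 1) powr of_real (2/5)" by simp
  also have "\<dots> = of_real (quartic 1 powr (2/5))"
    using quartic_pos[of 1] by (intro powr_of_real) auto
  finally show ?thesis
    by (simp add: arc_primitive_def q[simplified] incomplete_beta_def)
qed

text \<open>The exponential has phase 8/5 pi at the end of the arc. Rotating by -3/5 pi, which makes
  the phase of the derivative trivial beyond the root, leaves pi, hence the minus sign. It matches
  the factor sgn t in the derivative of \<open>outer_antideriv\<close> for t < -2.\<close>

lemma arc_primitive_pi:
  "Re (cis (-3/5 * pi) * arc_primitive (of_real pi)) = - incomplete_beta (quartic (-1))"
proof -
  have q: "arc_factor (of_real pi) = of_real (quartic (-1))"
  proof -
    have "cis (- pi) = -1" by (simp add: complex_eq_iff)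
    then show ?thesis unfolding arc_factor_cis by (simp add: quartic_def)
  qed
  have "(of_real (quartic (-1)) :: complex) powr (2/5) = of_real (quartic (-1)) powr of_real (2/5)" by simp
  also have "\<dots> = of_real (quartic (-1) powr (2/5))"
    using quartic_pos[of "-1"] by (intro powr_of_real) auto
  finally have p: "(of_real (quartic (-1)) :: complex) powr (2/5) = of_real (quartic (-1) powr (2/5))" .
  have e: "exp (4 * \<i> * of_real pi) = 1" "exp (8/5 * \<i> * of_real pi) = cis (8/5 * pi)"
    by (simp_all add: cis_conv_exp exp_eq_1 mult_ac)
  have "cis (-3/5 * pi) * cis (8/5 * pi) = -1"
    by (simp add: cis_mult)
  then have "cis (-3/5 * pi) * arc_primitive (of_real pi)
     = - (of_real (5/2 * quartic (-1) powr (2/5)) * beta_kernel (of_real (quartic (-1))))"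
    unfolding arc_primitive_def e q p by (simp add: mult.assoc[symmetric])
  then show ?thesis by (simp add: incomplete_beta_def)
qed

section \<open>The root of the cubic as a point of the unit circle\<close>

definition critical_angle :: real where "critical_angle = arccos (- sqrt 5 / 4)"

lemma critical_angle:
  "pi / 2 < critical_angle" "critical_angle < pi"
  "cos critical_angle = - sqrt 5 / 4" "sin critical_angle > 1/2"
proof -
  have s: "sqrt 5 / 4 < 1" "sqrt 5 / 4 > 0" using sqrt_5_half by auto
  show "cos critical_angle = - sqrt 5 / 4"
    unfolding critical_angle_def using s by (intro cos_arccos) linarith+
  have "arccos 0 < critical_angle" "critical_angle < arccos (-1)"
    unfolding critical_angle_def using s real_sqrt_ge_zero[of 5] by (intro arccos_less_arccos; linarith)+
  then show "pi / 2 < critical_angle" "critical_angle < pi" by simp_all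
  have "sin critical_angle = sqrt (1 - (- sqrt 5 / 4)\<^sup>2)"
    unfolding critical_angle_def using s by (intro sin_arccos) linarith+
  also have "1 - (- sqrt 5 / 4)\<^sup>2 = 11 / 16" by (simp add: power_divide)
  also have "sqrt (11/16) > 1/2" by (rule real_less_rsqrt) (simp add: power_divide)
  finally show "sin critical_angle > 1/2" .
qed

text \<open>Here x^4 times \<open>arc_factor\<close> is -2, so the kernel is a complete beta
  integral and \<open>arc_factor\<close> has argument 3 pi - 4 \<theta>. In the total phase 8/5
  \<theta> + 2/5 (3 pi - 4 \<theta>) the angle itself drops out.\<close>

lemma arc_primitive_critical_angle:
  "arc_primitive (of_real critical_angle) = of_real (2 powr (-1/5) * Beta (2/5) (2/5)) * cis (6/5 * pi)"
proof -
  define \<theta> where "\<theta> = critical_angle"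
  note \<theta> = critical_angle[folded \<theta>_def]
  have z: "cis \<theta> ^ 4 * arc_factor (of_real \<theta>) = -2"
    using two_plus_arc_value[of \<theta>] \<theta>(3) by (simp add: eq_neg_iff_add_eq_0 add.commute)
  have e: "exp (4 * \<i> * of_real \<theta>) = cis \<theta> ^ 4" "exp (8/5 * \<i> * of_real \<theta>) = cis (8/5 * \<theta>)"
    by (simp_all add: cis_conv_exp power4_eq_xxxx mult_ac flip: exp_add)
  have "arc_factor (of_real \<theta>) = cis (-4 * \<theta>) * (cis \<theta> ^ 4 * arc_factor (of_real \<theta>))"
    by (simp add: mult.assoc[symmetric] power4_eq_xxxx cis_mult)
  \<comment> \<open>Among the odd multiples of pi, 3 pi is the one that puts the argument into the
    principal range, since \<theta> lies between pi/2 and pi.\<close>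
  also have "\<dots> = of_real 2 * cis (3 * pi - 4 * \<theta>)"
    unfolding z by (simp add: complex_eq_iff cos_diff sin_diff)
  finally have "arc_factor (of_real \<theta>) powr of_real (2/5) = of_real (2 powr (2/5)) * cis (2/5 * (3 * pi - 4 * \<theta>))"
    using \<theta> by (simp only:) (intro powr_polar; simp)
  then have "arc_primitive (of_real \<theta>) = 5/2 * cis (8/5 * \<theta>)
      * (of_real (2 powr (2/5)) * cis (2/5 * (3 * pi - 4 * \<theta>)))
      * of_real (2 powr (-3/5) * (2/5 * Beta (2/5) (2/5)))"
    unfolding arc_primitive_def e z beta_kernel_minus_2 by simp
  also have "\<dots> = of_real (2 powr (2/5) * 2 powr (-3/5) * Beta (2/5) (2/5))
      * (cis (8/5 * \<theta>) * cis (2/5 * (3 * pi - 4 * \<theta>)))"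
    by simp
  also have "cis (8/5 * \<theta>) * cis (2/5 * (3 * pi - 4 * \<theta>)) = cis (6/5 * pi)"
    by (simp add: cis_mult algebra_simps)
  also have "2 powr (2/5) * 2 powr (-3/5) = (2 powr (-1/5) :: real)"
    by (simp flip: powr_add)
  finally show ?thesis by (simp add: \<theta>_def)
qed

text \<open>Multiplication by the conjugate of \<zeta> makes the second summand real. Geometrically,
  for nonzero \<zeta>, x has distance |x Im \<zeta>| / |\<zeta>| from the line spanned by
  \<zeta>.\<close>

lemma norm_real_combination_ge:
  "\<bar>x * Im \<zeta>\<bar> \<le> norm (of_real x + of_real y * \<zeta>) * norm \<zeta>"
proof -
  have "(of_real x + of_real y * \<zeta>) * cnj \<zeta> = Complex (x * Re \<zeta> + y * (norm \<zeta>)\<^sup>2) (- x * Im \<zeta>)"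
    unfolding cmod_power2 by (simp add: complex_eq_iff algebra_simps power2_eq_square)
  then have "\<bar>x * Im \<zeta>\<bar> = \<bar>Im ((of_real x + of_real y * \<zeta>) * cnj \<zeta>)\<bar>" by simp
  also have "\<dots> \<le> norm ((of_real x + of_real y * \<zeta>) * cnj \<zeta>)" by (rule abs_Im_le_cmod)
  finally show ?thesis by (simp add: norm_mult)
qed

text \<open>The curve z passes through the tip of the slit transversally: 2 + z is a real factor
  times \<zeta>, and \<zeta> stays off the real axis. Therefore 2 + u z = 2 (1 - u) + u a \<zeta>
  has norm at least a multiple of 1 - u, as the limit theorem for the kernel demands.\<close>

lemma isCont_arc_primitive_critical_angle:
  "isCont (\<lambda>\<theta>. arc_primitive (of_real \<theta>)) critical_angle"
proof -
  \<comment> \<open>A neighbourhood on which Im \<zeta> is at least 1/2; with |\<zeta>| at most 6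
    this gives the constant 1/6 below.\<close>
  define T where "T = {\<theta>. 0 < \<theta> \<and> \<theta> < pi \<and> cos \<theta> < 0 \<and> sin \<theta> > (1/2::real)}"
  have T: "open T" "critical_angle \<in> T"
    unfolding T_def using critical_angle pi_gt_zero
    by (auto intro!: open_Collect_conj open_Collect_less continuous_intros)
  define z where "z \<theta> = exp (4 * \<i> * of_real \<theta>) * arc_factor (of_real \<theta>)" for \<theta> :: real
  have z_cis: "z \<theta> = cis \<theta> ^ 4 * arc_factor (of_real \<theta>)" for \<theta>
    by (simp add: z_def cis_conv_exp power4_eq_xxxx mult_ac flip: exp_add)
  have z0: "z critical_angle = -2"
    using two_plus_arc_value[of critical_angle] critical_angle(3)
    by (simp add: z_cis eq_neg_iff_add_eq_0 add.commute)
  have contn: "isCont (\<lambda>\<theta>. arc_factor (of_real \<theta>)) \<theta>" for \<theta> :: real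
    unfolding arc_factor_def by (intro continuous_intros) auto
  have contz: "isCont z \<theta>" for \<theta>
    unfolding z_def by (intro continuous_intros contn)
  define a where "a \<theta> = 2 * cos \<theta> + sqrt 5 / 2" for \<theta> :: real
  define \<zeta> where "\<zeta> \<theta> = 2 * cis \<theta> * cnj (arc_factor (of_real \<theta>))" for \<theta>
  have z2: "2 + z \<theta> = of_real (a \<theta>) * \<zeta> \<theta>" for \<theta>
    unfolding z_cis two_plus_arc_value a_def \<zeta>_def by simp
  have Im: "Im (\<zeta> \<theta>) \<ge> 1/2" if "\<theta> \<in> T" for \<theta>
  proof -
    define w where "w = sqrt 5 / 2 * cos \<theta>"
    have "Im (\<zeta> \<theta>) = sin \<theta> * (4 * (cos \<theta>)\<^sup>2 - 4 * w + 1)"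
      by (simp add: \<zeta>_def w_def arc_factor_Re_Im algebra_simps power2_eq_square)
    moreover have "w \<le> 0"
      unfolding w_def using that by (intro mult_nonneg_nonpos) (auto simp: T_def)
    then have "sin \<theta> * (4 * (cos \<theta>)\<^sup>2 - 4 * w + 1) \<ge> 1/2 * 1"
      using that by (intro mult_mono) (auto simp: T_def intro: order_trans[OF _ zero_le_power2])
    ultimately show ?thesis by simp
  qed
  have nm: "norm (\<zeta> \<theta>) \<le> 6" for \<theta>
  proof -
    have "norm (arc_factor (of_real \<theta>)) \<le> norm (1 :: complex) + norm (of_real (sqrt 5 / 2) * cis (-\<theta>)) + norm (cis (-\<theta>) ^ 2 / 2)"
      unfolding arc_factor_cis using norm_triangle_ineq norm_triangle_ineq4 by (meson add_mono order_refl order_trans)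
    also have "\<dots> = 1 + sqrt 5 / 2 + 1/2" by (simp add: norm_mult norm_divide norm_power)
    also have "\<dots> \<le> 3" using sqrt_5_half(2) by simp
    finally show ?thesis by (simp add: \<zeta>_def norm_mult)
  qed
  have "((\<lambda>\<theta>. beta_kernel (z \<theta>)) \<longlongrightarrow> beta_kernel (-2)) (at critical_angle within T)"
    unfolding tendsto_at_iff_sequentially
  proof (intro allI impI)
    fix X assume X: "\<forall>i. X i \<in> T - {critical_angle}" "X \<longlonglongrightarrow> critical_angle"
    have "(\<lambda>i. beta_kernel (z (X i))) \<longlonglongrightarrow> beta_kernel (-2)"
    proof (rule beta_kernel_tendsto_minus_2[where c = "1/6"])
      show "(\<lambda>i. z (X i)) \<longlonglongrightarrow> -2"
        using isCont_tendsto_compose[OF contz X(2)] z0 by simp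
      fix i
      have XT: "X i \<in> T" using X by auto
      show "norm (2 + of_real u * z (X i)) \<ge> 1/6 * (1 - u)" if "0 \<le> u" "u \<le> 1" for u
      proof -
        have eq: "2 + of_real u * z (X i) = of_real (2 * (1 - u)) + of_real (u * a (X i)) * \<zeta> (X i)"
        proof -
          have "z (X i) = of_real (a (X i)) * \<zeta> (X i) - 2" using z2[of "X i"] by (simp add: algebra_simps)
          then show ?thesis by (simp only:) (simp add: algebra_simps)
        qed
        have "1 - u \<le> 2 * (1 - u) * Im (\<zeta> (X i))"
          using mult_left_mono[OF Im[OF XT], of "2 * (1 - u)"] that by simp
        also have "\<dots> \<le> norm (2 + of_real u * z (X i)) * norm (\<zeta> (X i))"
          unfolding eq by (rule order_trans[OF abs_ge_self norm_real_combination_ge])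
        also have "\<dots> \<le> norm (2 + of_real u * z (X i)) * 6"
          by (intro mult_left_mono nm) auto
        finally show ?thesis by simp
      qed
      have "cos (X i) \<noteq> cos critical_angle"
      proof
        assume *: "cos (X i) = cos critical_angle"
        have "0 < X i" "X i < pi" using XT unfolding T_def by blast+
        then have "X i = critical_angle"
          using critical_angle(1,2) pi_gt_zero * by (intro cos_inj_pi[OF _ _ _ _ *]) linarith+
        then show False using X by blast
      qed
      then have "a (X i) \<noteq> 0"
        by (simp add: a_def critical_angle(3))
      then have "Im (2 + z (X i)) \<noteq> 0"
        unfolding z2 using Im[OF XT] by simp
      then show "2 + z (X i) \<notin> \<real>\<^sub>\<le>\<^sub>0" by (auto simp: complex_nonpos_Reals_iff)
    qed auto
    then show "((\<lambda>\<theta>. beta_kernel (z \<theta>)) \<circ> X) \<longlonglongrightarrow> beta_kernel (-2)" by (simp add: o_def)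
  qed
  then have "((\<lambda>\<theta>. beta_kernel (z \<theta>)) \<longlongrightarrow> beta_kernel (z critical_angle)) (at critical_angle)"
    using at_within_open[OF T(2,1)] z0 by simp
  then have cb: "isCont (\<lambda>\<theta>. beta_kernel (z \<theta>)) critical_angle" by (simp add: isCont_def)
  have cp: "isCont (\<lambda>\<theta>. arc_factor (of_real \<theta>) powr (2/5)) \<theta>" for \<theta> :: real
    using arc_factor_Re_pos[of \<theta>]
    by (intro isCont_powr_complex contn continuous_const) (auto simp: complex_nonpos_Reals_iff)
  have "isCont (\<lambda>\<theta>. 5/2 * exp (8/5 * \<i> * of_real \<theta>)) critical_angle"
    by (intro continuous_intros)
  from continuous_mult[OF continuous_mult[OF this cp] cb] show ?thesis
    unfolding arc_primitive_def z_def .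
qed

section \<open>The integral of the cubic over the real line\<close>

text \<open>For |t| < 2 the points x and 1/x are conjugate, so their sum is twice a real part;
  divided by 3 as in \<open>outer_antideriv\<close> this gives the factor 2/3.\<close>

definition right_antideriv :: "real \<Rightarrow> real" where
  "right_antideriv t = (if t \<le> 2 then 2/3 * Re (arc_primitive (of_real (arccos (t / 2))))
                        else outer_antideriv t)"

text \<open>The rotation removes the phase acquired at the root, so that the derivative is again the
  positive power of |P|; the sign before \<open>outer_antideriv\<close> undoes sgn t.\<close>

definition left_antideriv :: "real \<Rightarrow> real" where
  "left_antideriv t = (if t \<ge> -2 then 2/3 * Re (cis (-3/5 * pi) * arc_primitive (of_real (arccos (t / 2))))
                       else - outer_antideriv t)"

lemma continuous_on_arc_primitive: "continuous_on {0..pi} (\<lambda>\<theta>. arc_primitive (of_real \<theta>))"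
  unfolding continuous_on_eq_continuous_within
proof
  fix \<theta> assume \<theta>: "\<theta> \<in> {0..pi}"
  show "continuous (at \<theta> within {0..pi}) (\<lambda>\<theta>. arc_primitive (of_real \<theta>))"
  proof (cases "2 * cos \<theta> + sqrt 5 / 2 = 0")
    case True
    then have "cos \<theta> = cos critical_angle" by (simp add: critical_angle(3))
    then have "\<theta> = critical_angle"
      using \<theta> critical_angle(1,2) pi_gt_zero
      by (intro cos_inj_pi[of \<theta> critical_angle]; simp)
    then show ?thesis using isCont_arc_primitive_critical_angle
      by (auto intro: continuous_at_imp_continuous_at_within)
  next
    case False
    then show ?thesis
      using arc_primitive_has_vector_derivative[OF _ _ False] \<theta>
      by (auto intro: continuous_at_imp_continuous_at_within has_vector_derivative_continuous)
  qed
qed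

text \<open>The real part of i (4 cis \<theta> - 3 r + cis(-\<theta>)), with r = sqrt 5 / 2, is -3
  sin \<theta>, and d\<theta>/dt = -1/(2 sin \<theta>); with 2/3 the product is 1. The rotation
  \<delta> covers both sides of the root.\<close>

lemma arc_composite_has_derivative:
  assumes t: "\<bar>t\<bar> < 2" "t + sqrt 5 / 2 \<noteq> 0"
    and \<delta>: "\<delta> * (if t + sqrt 5 / 2 > 0 then 1 else cis (3/5 * pi)) = 1"
  shows "((\<lambda>t. 2/3 * Re (\<delta> * arc_primitive (of_real (arccos (t / 2)))))
            has_real_derivative \<bar>cubic t\<bar> powr (-3/5)) (at t)"
proof -
  define \<theta> where "\<theta> = arccos (t / 2)"
  have t2: "-1 < t / 2" "t / 2 < 1" using t by auto
  have \<theta>: "0 \<le> \<theta>" "\<theta> \<le> pi" "2 * cos \<theta> = t"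
    using t2 by (auto simp: \<theta>_def arccos_lbound arccos_ubound)
  have sin_eq: "sin \<theta> = sqrt (1 - (t / 2)\<^sup>2)"
    unfolding \<theta>_def using t2 by (intro sin_arccos) auto
  have s0: "sin \<theta> > 0"
    unfolding \<theta>_def using t2 by (intro sin_gt_zero arccos_lt_bounded[THEN conjunct1] arccos_lt_bounded[THEN conjunct2]) auto
  define K where "K = \<bar>cubic t\<bar> powr (-3/5)"
  define \<epsilon> where "\<epsilon> = (if t + sqrt 5 / 2 > 0 then 1 else cis (3/5 * pi))"
  have "((\<lambda>\<theta>. arc_primitive (of_real \<theta>)) has_vector_derivative
     \<i> * (4 * cis \<theta> - 3 * of_real (sqrt 5 / 2) + cis (-\<theta>)) * \<epsilon> * of_real K) (at \<theta>)"
    using arc_primitive_has_vector_derivative[OF \<theta>(1,2)] t(2) unfolding \<theta>(3) by (simp add: \<epsilon>_def K_def)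
  then have "((\<lambda>\<theta>. \<delta> * arc_primitive (of_real \<theta>)) has_vector_derivative
     \<delta> * (\<i> * (4 * cis \<theta> - 3 * of_real (sqrt 5 / 2) + cis (-\<theta>)) * \<epsilon> * of_real K)) (at \<theta>)"
    by (rule has_vector_derivative_mult_right)
  also have "\<delta> * (\<i> * (4 * cis \<theta> - 3 * of_real (sqrt 5 / 2) + cis (-\<theta>)) * \<epsilon> * of_real K)
     = (\<delta> * \<epsilon>) * (\<i> * (4 * cis \<theta> - 3 * of_real (sqrt 5 / 2) + cis (-\<theta>)) * of_real K)"
    by (simp add: mult_ac)
  also have "\<delta> * \<epsilon> = 1" using \<delta> by (simp add: \<epsilon>_def)
  finally have "((\<lambda>\<theta>. Re (\<delta> * arc_primitive (of_real \<theta>))) has_real_derivative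
     Re (1 * (\<i> * (4 * cis \<theta> - 3 * of_real (sqrt 5 / 2) + cis (-\<theta>)) * of_real K))) (at \<theta>)"
    by (simp only: has_vector_derivative_complex_iff)
  also have "Re (1 * (\<i> * (4 * cis \<theta> - 3 * of_real (sqrt 5 / 2) + cis (-\<theta>)) * of_real K)) = - 3 * sin \<theta> * K"
    by (simp add: algebra_simps)
  finally have d: "((\<lambda>\<theta>. Re (\<delta> * arc_primitive (of_real \<theta>))) has_real_derivative - 3 * sin \<theta> * K) (at \<theta>)" .
  have "((\<lambda>t. arccos (t / 2)) has_real_derivative inverse (- sqrt (1 - (t / 2)\<^sup>2)) * (1 / 2)) (at t)"
    by (rule DERIV_chain2[where f = arccos and g = "\<lambda>t. t / 2" and x = t, OF DERIV_arccos])
       (use t2 in \<open>auto intro!: derivative_eq_intros\<close>)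
  also have "inverse (- sqrt (1 - (t / 2)\<^sup>2)) * (1 / 2) = - 1 / (2 * sin \<theta>)"
    unfolding sin_eq[symmetric] using s0 by (simp add: field_simps)
  finally have "((\<lambda>t. Re (\<delta> * arc_primitive (of_real (arccos (t / 2))))) has_real_derivative
      - 3 * sin \<theta> * K * (- 1 / (2 * sin \<theta>))) (at t)"
    unfolding \<theta>_def
    by (rule DERIV_chain2[where f = "\<lambda>\<theta>. Re (\<delta> * arc_primitive (of_real \<theta>))"
          and g = "\<lambda>t. arccos (t / 2)" and x = t, OF d[unfolded \<theta>_def]])
  from DERIV_cmult[OF this, of "2/3"]
  show ?thesis using s0 unfolding K_def by (simp add: mult.assoc)
qed

text \<open>The joint t = 2 is left out: \<open>arccos\<close> and the square root degenerate there,
  and continuity across it is all that is needed later.\<close>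

lemma right_antideriv_has_derivative:
  assumes t: "t > - (sqrt 5 / 2)" "t \<noteq> 2"
  shows "(right_antideriv has_real_derivative \<bar>cubic t\<bar> powr (-3/5)) (at t)"
proof (cases "t < 2")
  case True
  then have a: "\<bar>t\<bar> < 2" using t sqrt_5_half(2) by linarith
  have "((\<lambda>t. 2/3 * Re (1 * arc_primitive (of_real (arccos (t / 2)))))
            has_real_derivative \<bar>cubic t\<bar> powr (-3/5)) (at t)"
    by (rule arc_composite_has_derivative) (use t a in auto)
  then show ?thesis
    by (rule has_field_derivative_transform_within_open[where S = "{..<2}"])
       (use True in \<open>auto simp: right_antideriv_def\<close>)
next
  case False
  with t have "t > 2" by simp
  then have "(outer_antideriv has_real_derivative \<bar>cubic t\<bar> powr (-3/5)) (at t)"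
    using outer_antideriv_has_derivative[of t] by simp
  then show ?thesis
    by (rule has_field_derivative_transform_within_open[where S = "{2<..}"])
       (use \<open>t > 2\<close> in \<open>auto simp: right_antideriv_def\<close>)
qed

lemma left_antideriv_has_derivative:
  assumes t: "t < - (sqrt 5 / 2)" "t \<noteq> -2"
  shows "(left_antideriv has_real_derivative \<bar>cubic t\<bar> powr (-3/5)) (at t)"
proof (cases "t > -2")
  case True
  then have a: "\<bar>t\<bar> < 2" using t sqrt_5_half(1) by linarith
  have "((\<lambda>t. 2/3 * Re (cis (-3/5 * pi) * arc_primitive (of_real (arccos (t / 2)))))
            has_real_derivative \<bar>cubic t\<bar> powr (-3/5)) (at t)"
    by (rule arc_composite_has_derivative) (use t a in \<open>auto simp: cis_mult\<close>)
  then show ?thesis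
    by (rule has_field_derivative_transform_within_open[where S = "{-2<..}"])
       (use True in \<open>auto simp: left_antideriv_def\<close>)
next
  case False
  with t have "t < -2" by simp
  then have "((\<lambda>t. - outer_antideriv t) has_real_derivative \<bar>cubic t\<bar> powr (-3/5)) (at t)"
    using DERIV_minus[OF outer_antideriv_has_derivative[of t]] by simp
  then show ?thesis
    by (rule has_field_derivative_transform_within_open[where S = "{..<-2}"])
       (use \<open>t < -2\<close> in \<open>auto simp: left_antideriv_def\<close>)
qed

lemma continuous_on_arc_composite:
  "continuous_on {-2..2} (\<lambda>t. 2/3 * Re (\<delta> * arc_primitive (of_real (arccos (t / 2)))))"
proof -
  have "continuous_on {-2..2} (\<lambda>t::real. arccos (t / 2))"
    by (intro continuous_on_arccos' continuous_intros) auto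
  then have "continuous_on {-2..2} (\<lambda>t. arc_primitive (of_real (arccos (t / 2))))"
    by (rule continuous_on_compose2[OF continuous_on_arc_primitive]) (auto intro!: arccos_lbound arccos_ubound)
  then show ?thesis by (intro continuous_intros)
qed

lemma continuous_on_outer_antideriv: "continuous_on {t. \<bar>t\<bar> \<ge> 2} outer_antideriv"
proof -
  have ib: "continuous_on {0<..} incomplete_beta"
    using incomplete_beta_has_derivative
    by (intro continuous_at_imp_continuous_on ballI) (auto intro: DERIV_isCont)
  have pos: "quartic ((t + sqrt (t\<^sup>2 - 4)) / 2) > 0" "quartic ((t - sqrt (t\<^sup>2 - 4)) / 2) > 0"
    if "\<bar>t\<bar> \<ge> 2" for t :: real
  proof -
    have "t\<^sup>2 \<ge> 4" using power_mono[of 2 "\<bar>t\<bar>" 2] that by simp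
    then have "((t + sqrt (t\<^sup>2 - 4)) / 2) * ((t - sqrt (t\<^sup>2 - 4)) / 2) = 1"
      by (simp add: algebra_simps power2_eq_square flip: diff_divide_distrib)
    then have "(t + sqrt (t\<^sup>2 - 4)) / 2 \<noteq> 0" "(t - sqrt (t\<^sup>2 - 4)) / 2 \<noteq> 0"
      by (metis mult_zero_left zero_neq_one, metis mult_zero_right zero_neq_one)
    then show "quartic ((t + sqrt (t\<^sup>2 - 4)) / 2) > 0" "quartic ((t - sqrt (t\<^sup>2 - 4)) / 2) > 0"
      using quartic_pos by blast+
  qed
  have qc: "continuous_on S (\<lambda>t. quartic (f t))" if "continuous_on S f" for S :: "real set" and f :: "real \<Rightarrow> real"
    unfolding quartic_def using that by (intro continuous_intros) auto
  have "continuous_on {t. \<bar>t\<bar> \<ge> 2} (\<lambda>t. quartic ((t + sqrt (t\<^sup>2 - 4)) / 2))"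
    by (rule qc) (auto intro!: continuous_intros)
  moreover have "continuous_on {t. \<bar>t\<bar> \<ge> 2} (\<lambda>t. quartic ((t - sqrt (t\<^sup>2 - 4)) / 2))"
    by (rule qc) (auto intro!: continuous_intros)
  ultimately have "continuous_on {t. \<bar>t\<bar> \<ge> 2} (\<lambda>t. incomplete_beta (quartic ((t + sqrt (t\<^sup>2 - 4)) / 2)))"
    "continuous_on {t. \<bar>t\<bar> \<ge> 2} (\<lambda>t. incomplete_beta (quartic ((t - sqrt (t\<^sup>2 - 4)) / 2)))"
    using pos by (auto intro!: continuous_on_compose2[OF ib])
  then show ?thesis
    unfolding outer_antideriv_def[abs_def] by (intro continuous_intros) auto
qed

lemma continuous_on_right_antideriv: "continuous_on {- (sqrt 5 / 2)..} right_antideriv"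
proof -
  have "continuous_on ({- (sqrt 5 / 2)..2} \<union> {2..}) right_antideriv"
    unfolding right_antideriv_def[abs_def]
  proof (rule continuous_on_If)
    show "continuous_on {- (sqrt 5 / 2)..2} (\<lambda>t. 2/3 * Re (arc_primitive (of_real (arccos (t / 2)))))"
      using continuous_on_subset[OF continuous_on_arc_composite[of 1]] sqrt_5_half(2) by simp
    show "continuous_on {2..} outer_antideriv"
      by (rule continuous_on_subset[OF continuous_on_outer_antideriv]) auto
    show "2/3 * Re (arc_primitive (of_real (arccos (t / 2)))) = outer_antideriv t"
      if "t \<in> {- (sqrt 5 / 2)..2}" "\<not> t \<le> 2" for t using that by auto
    show "2/3 * Re (arc_primitive (of_real (arccos (t / 2)))) = outer_antideriv t"
      if "t \<in> {2..}" "t \<le> 2" for t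
    proof -
      have "t = 2" using that by simp
      then show ?thesis using arc_primitive_0 by (simp add: outer_antideriv_def)
    qed
  qed auto
  then show ?thesis
    by (rule continuous_on_subset) auto
qed

lemma continuous_on_left_antideriv: "continuous_on {..- (sqrt 5 / 2)} left_antideriv"
proof -
  have "continuous_on ({-2..- (sqrt 5 / 2)} \<union> {..-2}) left_antideriv"
    unfolding left_antideriv_def[abs_def]
  proof (rule continuous_on_If)
    show "continuous_on {-2..- (sqrt 5 / 2)} (\<lambda>t. 2/3 * Re (cis (-3/5 * pi) * arc_primitive (of_real (arccos (t / 2)))))"
      by (rule continuous_on_subset[OF continuous_on_arc_composite]) (use sqrt_5_half in auto)
    show "continuous_on {..-2} (\<lambda>t. - outer_antideriv t)"
      by (intro continuous_intros continuous_on_subset[OF continuous_on_outer_antideriv]) auto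
    show "2/3 * Re (cis (-3/5 * pi) * arc_primitive (of_real (arccos (t / 2)))) = - outer_antideriv t"
      if "t \<in> {-2..- (sqrt 5 / 2)}" "\<not> t \<ge> -2" for t using that by auto
    show "2/3 * Re (cis (-3/5 * pi) * arc_primitive (of_real (arccos (t / 2)))) = - outer_antideriv t"
      if "t \<in> {..-2}" "t \<ge> -2" for t
    proof -
      have t: "t = -2" using that by simp
      then have "arccos (t / 2) = pi" by simp
      then show ?thesis unfolding t using arc_primitive_pi by (simp add: outer_antideriv_def)
    qed
  qed auto
  then show ?thesis
    by (rule continuous_on_subset) auto
qed

section \<open>The value at the root and the cancellation at infinity\<close>

lemma cos_pi_5: "cos (pi / 5) = (1 + sqrt 5) / 4"
proof -
  \<comment> \<open>Since 3 (pi/5) and 2 (pi/5) add up to pi, their cosines are opposite; this is a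
    cubic equation for c with the spurious root -1.\<close>
  define c where "c = cos (pi / 5)"
  have "cos (3 * (pi / 5)) = - cos (2 * (pi / 5))"
    using cos_minus_pi[of "3 * (pi / 5)"] by (simp add: cos_diff field_simps) 
  moreover have "cos (3 * (pi / 5)) = 4 * c ^ 3 - 3 * c" "cos (2 * (pi / 5)) = 2 * c\<^sup>2 - 1"
    unfolding c_def by (rule cos_treble_cos cos_double_cos)+
  ultimately have "4 * c ^ 3 - 3 * c = - (2 * c\<^sup>2 - 1)" by simp
  then have "(c + 1) * (4 * c\<^sup>2 - 2 * c - 1) = 0" by algebra
  moreover have c0: "c > 0" unfolding c_def by (intro cos_gt_zero) auto
  ultimately have "4 * c\<^sup>2 - 2 * c - 1 = 0" by auto
  then have "(4 * c - 1)\<^sup>2 = 5" by algebra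
  then have "\<bar>4 * c - 1\<bar> = sqrt 5" by (metis real_sqrt_abs)
  moreover have "4 * c - 1 > - sqrt 5" using c0 sqrt_5_half(1) by linarith
  ultimately show ?thesis by (simp add: c_def[symmetric] abs_if split: if_splits)
qed

text \<open>Both values come from the same complete beta integral, but with phase 6/5 pi from the
  right and 3/5 pi from the left.\<close>

lemma antideriv_at_root:
  "right_antideriv (- (sqrt 5 / 2)) + left_antideriv (- (sqrt 5 / 2))
     = - (sqrt 5 / 3 * (2 powr (-1/5) * Beta (2/5) (2/5)))"
proof -
  define K where "K = 2 powr (-1/5) * Beta (2/5) (2/5 :: real)"
  have ca: "arccos (- (sqrt 5 / 2) / 2) = critical_angle" by (simp add: critical_angle_def)
  have "right_antideriv (- (sqrt 5 / 2)) = 2/3 * (K * cos (6/5 * pi))"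
    using sqrt_5_half unfolding right_antideriv_def ca arc_primitive_critical_angle K_def by simp
  moreover have "left_antideriv (- (sqrt 5 / 2)) = 2/3 * (K * cos (3/5 * pi))"
  proof -
    have "cis (-3/5 * pi) * (of_real K * cis (6/5 * pi)) = of_real K * (cis (-3/5 * pi) * cis (6/5 * pi))"
      by (rule mult.left_commute)
    also have "cis (-3/5 * pi) * cis (6/5 * pi) = cis (3/5 * pi)"
      by (simp only: cis_mult) simp
    finally have eq: "cis (-3/5 * pi) * (of_real K * cis (6/5 * pi)) = of_real K * cis (3/5 * pi)" .
    have "- (sqrt 5 / 2) \<ge> -2" using sqrt_5_half by simp
    then have "left_antideriv (- (sqrt 5 / 2)) = 2/3 * Re (cis (-3/5 * pi) * arc_primitive (of_real critical_angle))"
      unfolding left_antideriv_def ca by (rule if_P)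
    then show ?thesis
      unfolding arc_primitive_critical_angle K_def[symmetric] eq by simp
  qed
  moreover have "cos (6/5 * pi) = - ((1 + sqrt 5) / 4)"
    using cos_periodic_pi[of "pi / 5"] by (simp add: cos_pi_5 field_simps)
  moreover have "cos (2 * (pi / 5)) = (sqrt 5 - 1) / 4"
    unfolding cos_double_cos cos_pi_5 by (simp add: power2_eq_square field_simps)
  then have "cos (3/5 * pi) = - ((sqrt 5 - 1) / 4)"
    using cos_minus_pi[of "3 * (pi / 5)"] by (simp add: cos_diff field_simps)
  ultimately have "right_antideriv (- (sqrt 5 / 2)) + left_antideriv (- (sqrt 5 / 2))
     = 2/3 * (K * - ((1 + sqrt 5) / 4)) + 2/3 * (K * - ((sqrt 5 - 1) / 4))"
    by (simp only:)
  also have "\<dots> = - (sqrt 5 / 3 * K)" by (simp add: field_simps)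
  finally show ?thesis by (simp add: K_def)
qed

text \<open>The large preimage is the one with plus sign at +infinity and the one with minus sign at
  -infinity. Pairing large with large, the limits of the incomplete beta integral cancel; the small
  preimages tend to 0 and contribute nothing.\<close>

lemma outer_antideriv_diff_tendsto:
  assumes f: "filterlim f at_top F" and g: "filterlim g at_bot F"
  shows "((\<lambda>x. outer_antideriv (f x) - outer_antideriv (g x)) \<longlongrightarrow> 0) F"
proof -
  let ?p = "\<lambda>t::real. quartic ((t + sqrt (t\<^sup>2 - 4)) / 2)"
  let ?m = "\<lambda>t::real. quartic ((t - sqrt (t\<^sup>2 - 4)) / 2)"
  have nonneg: "quartic x \<ge> 0" for x :: real
    using quartic_pos[of x] by (cases "x = 0") (auto simp: quartic_def)
  have "filterlim ?p at_top at_top" "(?m \<longlongrightarrow> 0) at_top" "filterlim ?m at_top at_bot" "(?p \<longlongrightarrow> 0) at_bot"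
    unfolding quartic_def of_real_eq_id id_apply by real_asymp+
  then have l: "filterlim (\<lambda>x. ?p (f x)) at_top F" "((\<lambda>x. ?m (f x)) \<longlongrightarrow> 0) F"
      "filterlim (\<lambda>x. ?m (g x)) at_top F" "((\<lambda>x. ?p (g x)) \<longlongrightarrow> 0) F"
    using f g by (auto intro: filterlim_compose[rotated])
  have "((\<lambda>x. ((incomplete_beta (?p (f x)) - incomplete_beta (?m (g x)))
        + (incomplete_beta (?m (f x)) - incomplete_beta (?p (g x)))) / 3) \<longlongrightarrow> (0 + (0 - 0)) / 3) F"
    by (intro tendsto_intros incomplete_beta_diff_tendsto_0 incomplete_beta_tendsto_0 l always_eventually allI nonneg) auto
  then show ?thesis by (simp add: outer_antideriv_def diff_divide_distrib add_divide_distrib algebra_simps)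
qed

text \<open>\<open>kappa\<close> is \<open>2 * sqrt (125/128)\<close>; this is where the argument of the series enters.\<close>

definition kappa :: real where "kappa = 5 * sqrt 10 / 8"

lemma kappa: "kappa > 0" "kappa\<^sup>2 = 125/32" "kappa < 2" "sqrt 2 * sqrt 5 / 2 * 5 / 4 = kappa"
proof -
  show "kappa > 0" "kappa\<^sup>2 = 125/32" by (simp_all add: kappa_def power_mult_distrib power_divide)
  then show "kappa < 2" by (intro power2_less_imp_less[of kappa 2]) auto
  show "sqrt 2 * sqrt 5 / 2 * 5 / 4 = kappa"
    by (simp add: kappa_def flip: real_sqrt_mult)
qed

text \<open>The real root is moved to 0, and the scale 2 sqrt 2 makes the outer coefficients of the
  quadratic factor equal (both are 8 before normalization). Only \<open>kappa\<close> is left as a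
  parameter.\<close>

lemma cubic_shift:
  "cubic (- (sqrt 5 / 2) + 2 * sqrt 2 * v) = 16 * sqrt 2 * (v * (1 + v\<^sup>2 - kappa * v))"
proof -
  define r q where "r = sqrt 5 / 2" and "q = sqrt 2"
  have r: "r\<^sup>2 = 5/4" and q: "q\<^sup>2 = 2" by (simp_all add: r_def q_def power_divide)
  have k: "kappa = q * r * 5 / 4" using kappa(4) by (simp add: r_def q_def)
  have "(- r + 2 * q * v + r) * ((- r + 2 * q * v)\<^sup>2 - 3 * r * (- r + 2 * q * v) + 3)
      = 2 * q * v * (4 * r\<^sup>2 + 3 - 10 * q * r * v + 4 * q\<^sup>2 * v\<^sup>2)"
    by (simp add: algebra_simps power2_eq_square)
  also have "\<dots> = 16 * q * (v * (1 + v\<^sup>2 - kappa * v))"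
    unfolding r q k by (simp add: algebra_simps)
  finally show ?thesis by (simp add: cubic_def r_def q_def)
qed

text \<open>For v = \<open>ratio_sqrt y\<close> with 0 <= y < 1 one has 1 + v^2 = 1/(1 - y) and v/(1
  + v^2) = sqrt (y (1 - y)). The quadratic 1 - kappa v + v^2 becomes a binomial in sqrt (y (1 - y)),
  whose powers integrate to Beta values.\<close>

definition ratio_sqrt :: "real \<Rightarrow> real" where "ratio_sqrt y = sqrt (y / (1 - y))"

text \<open>
  The two halves of the real line to the right and left of the root \<open>- sqrt 5 / 2\<close> of \<open>cubic\<close> are
  swept simultaneously by \<open>- sqrt 5 / 2 \<plusminus> 2 * sqrt 2 * ratio_sqrt y\<close> for \<open>y\<close> from \<open>0\<close> to \<open>1\<close>. At
  \<open>y = 1\<close>, where \<open>ratio_sqrt\<close> has a junk value, the antiderivative is given its limit \<open>0\<close>.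
\<close>

definition swept_antideriv :: "real \<Rightarrow> real" where
  "swept_antideriv y = (if y < 1 then right_antideriv (- (sqrt 5 / 2) + 2 * sqrt 2 * ratio_sqrt y)
                         + left_antideriv (- (sqrt 5 / 2) - 2 * sqrt 2 * ratio_sqrt y) else 0)"

text \<open>The minus sign is sgn P: the half-line left of the root counts negatively, so that only
  odd powers of \<open>kappa\<close> survive in the expansion.\<close>

definition binomial_density :: "real \<Rightarrow> real" where
  "binomial_density y = y powr (-4/5) * (1 - y) powr (-3/5)
     * ((1 - kappa * sqrt (y * (1 - y))) powr (-3/5) - (1 + kappa * sqrt (y * (1 - y))) powr (-3/5))"

lemma kappa_sqrt_less_1:
  assumes "0 \<le> y" "y \<le> 1"
  shows "0 \<le> kappa * sqrt (y * (1 - y))" "kappa * sqrt (y * (1 - y)) < 1"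
proof -
  show "0 \<le> kappa * sqrt (y * (1 - y))" using assms kappa(1) by simp
  have "y * (1 - y) \<le> (1/2)\<^sup>2"
    using zero_le_power2[of "y - 1/2"] by (simp add: power2_eq_square algebra_simps)
  then have "sqrt (y * (1 - y)) \<le> 1/2" by (intro real_le_lsqrt) auto
  then have "kappa * sqrt (y * (1 - y)) \<le> kappa * (1/2)" using kappa(1) by (intro mult_left_mono) auto
  then show "kappa * sqrt (y * (1 - y)) < 1" using kappa(3) by simp
qed

lemma swept_antideriv_has_derivative:
  assumes y: "0 < y" "y < 1"
    and ne: "- (sqrt 5 / 2) + 2 * sqrt 2 * ratio_sqrt y \<noteq> 2" "- (sqrt 5 / 2) - 2 * sqrt 2 * ratio_sqrt y \<noteq> -2"
  shows "(swept_antideriv has_real_derivative 2 powr (-11/5) * binomial_density y) (at y)"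
proof -
  define v where "v = ratio_sqrt y"
  define s where "s = sqrt (y * (1 - y))"
  have s: "s > 0" "s\<^sup>2 = y * (1 - y)" using y by (simp_all add: s_def)
  have v: "v > 0" using y by (simp add: v_def ratio_sqrt_def)
  have vs: "v = s / (1 - y)"
  proof -
    have "s / (1 - y) = sqrt (y * (1 - y)) / sqrt ((1 - y)\<^sup>2)" using y by (simp add: s_def)
    also have "\<dots> = sqrt (y * (1 - y) / (1 - y)\<^sup>2)" by (simp only: real_sqrt_divide)
    also have "y * (1 - y) / (1 - y)\<^sup>2 = y / (1 - y)" using y by (simp add: power2_eq_square)
    finally show ?thesis by (simp add: v_def ratio_sqrt_def)
  qed
  have v2: "1 + v\<^sup>2 = 1 / (1 - y)"
    using y by (simp add: v_def ratio_sqrt_def field_simps)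
  have c1: "v * (1 + v\<^sup>2 - k * v) = s * (1 - k * s) / (1 - y)\<^sup>2" for k
    unfolding v2 using y by (simp add: vs field_simps power2_eq_square)
  have ks: "0 \<le> kappa * s" "kappa * s < 1" using kappa_sqrt_less_1[of y] y by (simp_all add: s_def)
  have dv: "(ratio_sqrt has_real_derivative 1 / (2 * s * (1 - y))) (at y)"
  proof -
    have pos: "y / (1 - y) > 0" using y by simp
    have "((\<lambda>y. y / (1 - y)) has_real_derivative 1 / (1 - y)\<^sup>2) (at y)"
      using y by (auto intro!: derivative_eq_intros simp: field_simps power2_eq_square)
    then have "(ratio_sqrt has_real_derivative inverse (sqrt (y / (1 - y))) / 2 * (1 / (1 - y)\<^sup>2)) (at y)"
      unfolding ratio_sqrt_def[abs_def]
      by (rule DERIV_chain2[where f = sqrt and g = "\<lambda>y. y / (1 - y)" and x = y, OF DERIV_real_sqrt[OF pos]])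
    also have "inverse (sqrt (y / (1 - y))) / 2 * (1 / (1 - y)\<^sup>2) = 1 / (2 * s * (1 - y))"
    proof -
      have e: "sqrt (y / (1 - y)) = s / (1 - y)" using vs by (simp add: v_def ratio_sqrt_def)
      show ?thesis unfolding e using y s by (simp add: divide_simps power2_eq_square)
    qed
    finally show ?thesis .
  qed
  \<comment> \<open>Used with k = kappa to the right of the root and k = -kappa to the left. The
    exponents add up to -27/10 + 1/2 for 2, -3/10 - 1/2 for y, and 9/10 - 3/2 for 1 - y.\<close>
  have pw: "\<bar>16 * sqrt 2 * (s * (1 - k * s) / (1 - y)\<^sup>2)\<bar> powr (-3/5) * (2 * sqrt 2 * (1 / (2 * s * (1 - y))))
     = 2 powr (-11/5) * (y powr (-4/5) * (1 - y) powr (-3/5)) * (1 - k * s) powr (-3/5)"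
    if k: "1 - k * s > 0" for k
  proof -
    have q: "sqrt 2 = 2 powr (1/2)" by (simp add: powr_half_sqrt)
    have s': "s = y powr (1/2) * (1 - y) powr (1/2)"
      using y by (simp add: s_def powr_half_sqrt real_sqrt_mult)
    have "\<bar>16 * sqrt 2 * (s * (1 - k * s) / (1 - y)\<^sup>2)\<bar>
        = 2 powr (9/2) * (y powr (1/2) * (1 - y) powr (-3/2)) * (1 - k * s)"
    proof -
      have "16 * sqrt 2 = 2 powr 4 * 2 powr (1/2)" by (simp add: q)
      also have "\<dots> = 2 powr (9/2)" by (simp only: powr_add[symmetric]) simp
      finally have f1: "16 * sqrt 2 = 2 powr (9/2)" .
      have "s / (1 - y)\<^sup>2 = y powr (1/2) * ((1 - y) powr (1/2) * (1 - y) powr (-2))"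
      proof -
        have "(1 - y) powr (-2) = 1 / (1 - y)\<^sup>2"
          using y by (simp add: powr_minus powr_numeral divide_inverse)
        then show ?thesis unfolding s' by simp
      qed
      also have "(1 - y) powr (1/2) * (1 - y) powr (-2) = (1 - y) powr (-3/2)"
        by (simp only: powr_add[symmetric]) simp
      finally have f2: "s / (1 - y)\<^sup>2 = y powr (1/2) * (1 - y) powr (-3/2)" .
      have "16 * sqrt 2 * (s * (1 - k * s) / (1 - y)\<^sup>2) = 16 * sqrt 2 * (s / (1 - y)\<^sup>2) * (1 - k * s)"
        by simp
      also have "\<dots> = 2 powr (9/2) * (y powr (1/2) * (1 - y) powr (-3/2)) * (1 - k * s)"
        unfolding f1 f2 ..
      finally show ?thesis using k by simp
    qed
    moreover have "(2 powr (9/2) * (y powr (1/2) * (1 - y) powr (-3/2)) * (1 - k * s)) powr (-3/5)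
      = 2 powr (-27/10) * (y powr (-3/10) * (1 - y) powr (9/10)) * (1 - k * s) powr (-3/5)"
      by (simp add: powr_mult powr_powr)
    moreover have "2 * sqrt 2 * (1 / (2 * s * (1 - y))) = 2 powr (1/2) * (y powr (-1/2) * (1 - y) powr (-3/2))"
    proof -
      define Y Z where "Y = y powr (1/2)" and "Z = (1 - y) powr (1/2)"
      have YZ: "Y > 0" "Z > 0" using y by (simp_all add: Y_def Z_def)
      have e: "y powr (-1/2) = 1 / Y" "(1 - y) powr (-1/2) = 1 / Z"
        using powr_minus_divide[of y "1/2"] powr_minus_divide[of "1 - y" "1/2"] by (simp_all add: Y_def Z_def)
      have "(1 - y) powr (-3/2) = (1 - y) powr (-1/2) * (1 - y) powr (-1)"
        by (simp only: powr_add[symmetric]) simp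
      also have "(1 - y) powr (-1) = 1 / (1 - y)" using y by (simp add: powr_minus divide_inverse)
      finally have e': "(1 - y) powr (-3/2) = 1 / Z * (1 / (1 - y))" unfolding e .
      have e'': "s = Y * Z" unfolding Y_def Z_def by (rule s')
      show ?thesis unfolding q e e' e'' using YZ y by (simp add: field_simps)
    qed
    ultimately have "\<bar>16 * sqrt 2 * (s * (1 - k * s) / (1 - y)\<^sup>2)\<bar> powr (-3/5) * (2 * sqrt 2 * (1 / (2 * s * (1 - y))))
      = (2 powr (-27/10) * 2 powr (1/2)) * ((y powr (-3/10) * y powr (-1/2))
          * ((1 - y) powr (9/10) * (1 - y) powr (-3/2))) * (1 - k * s) powr (-3/5)"
      by (simp only: mult_ac)
    also have "\<dots> = 2 powr (-11/5) * (y powr (-4/5) * (1 - y) powr (-3/5)) * (1 - k * s) powr (-3/5)"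
      by (simp only: powr_add[symmetric]) simp
    finally show ?thesis .
  qed
  have tp: "((\<lambda>y. - (sqrt 5 / 2) + 2 * sqrt 2 * ratio_sqrt y) has_real_derivative 2 * sqrt 2 * (1 / (2 * s * (1 - y)))) (at y)"
    using DERIV_add[OF DERIV_const DERIV_cmult[OF dv], of "- (sqrt 5 / 2)" "2 * sqrt 2"] by simp
  have tm: "((\<lambda>y. - (sqrt 5 / 2) - 2 * sqrt 2 * ratio_sqrt y) has_real_derivative - (2 * sqrt 2 * (1 / (2 * s * (1 - y))))) (at y)"
    using DERIV_diff[OF DERIV_const DERIV_cmult[OF dv], of "- (sqrt 5 / 2)" "2 * sqrt 2"] by simp
  have cp: "cubic (- (sqrt 5 / 2) + 2 * sqrt 2 * ratio_sqrt y) = 16 * sqrt 2 * (s * (1 - kappa * s) / (1 - y)\<^sup>2)"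
    using cubic_shift[of v] unfolding c1 by (simp add: v_def)
  have cm: "\<bar>cubic (- (sqrt 5 / 2) - 2 * sqrt 2 * ratio_sqrt y)\<bar> = \<bar>16 * sqrt 2 * (s * (1 - (- kappa) * s) / (1 - y)\<^sup>2)\<bar>"
  proof -
    have "cubic (- (sqrt 5 / 2) - 2 * sqrt 2 * v) = - (16 * sqrt 2 * (v * (1 + v\<^sup>2 - (- kappa) * v)))"
      using cubic_shift[of "-v"] by (simp add: algebra_simps)
    then have "cubic (- (sqrt 5 / 2) - 2 * sqrt 2 * v) = - (16 * sqrt 2 * (s * (1 - (- kappa) * s) / (1 - y)\<^sup>2))"
      unfolding c1 .
    then show ?thesis unfolding v_def by (simp only: abs_minus_cancel)
  qed
  have "((\<lambda>y. right_antideriv (- (sqrt 5 / 2) + 2 * sqrt 2 * ratio_sqrt y)) has_real_derivative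
      2 powr (-11/5) * (y powr (-4/5) * (1 - y) powr (-3/5)) * (1 - kappa * s) powr (-3/5)) (at y)"
  proof -
    have "(right_antideriv has_real_derivative \<bar>cubic (- (sqrt 5 / 2) + 2 * sqrt 2 * ratio_sqrt y)\<bar> powr (-3/5))
       (at (- (sqrt 5 / 2) + 2 * sqrt 2 * ratio_sqrt y))"
      using v ne(1) by (intro right_antideriv_has_derivative) (auto simp: v_def)
    from DERIV_chain2[where f = right_antideriv and g = "\<lambda>y. - (sqrt 5 / 2) + 2 * sqrt 2 * ratio_sqrt y" and x = y, OF this tp]
    show ?thesis unfolding cp using pw[of kappa] ks by simp
  qed
  moreover have "((\<lambda>y. left_antideriv (- (sqrt 5 / 2) - 2 * sqrt 2 * ratio_sqrt y)) has_real_derivative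
      - (2 powr (-11/5) * (y powr (-4/5) * (1 - y) powr (-3/5)) * (1 - (- kappa) * s) powr (-3/5))) (at y)"
  proof -
    have "(left_antideriv has_real_derivative \<bar>cubic (- (sqrt 5 / 2) - 2 * sqrt 2 * ratio_sqrt y)\<bar> powr (-3/5))
       (at (- (sqrt 5 / 2) - 2 * sqrt 2 * ratio_sqrt y))"
      using v ne(2) by (intro left_antideriv_has_derivative) (auto simp: v_def)
    from DERIV_chain2[where f = left_antideriv and g = "\<lambda>y. - (sqrt 5 / 2) - 2 * sqrt 2 * ratio_sqrt y" and x = y, OF this tm]
    have "((\<lambda>y. left_antideriv (- (sqrt 5 / 2) - 2 * sqrt 2 * ratio_sqrt y)) has_real_derivative
       - (\<bar>16 * sqrt 2 * (s * (1 - (- kappa) * s) / (1 - y)\<^sup>2)\<bar> powr (-3/5) * (2 * sqrt 2 * (1 / (2 * s * (1 - y)))))) (at y)"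
      unfolding cm by (simp only: mult_minus_right)
    then show ?thesis using pw[of "- kappa"] ks by simp
  qed
  ultimately have "((\<lambda>y. right_antideriv (- (sqrt 5 / 2) + 2 * sqrt 2 * ratio_sqrt y)
                         + left_antideriv (- (sqrt 5 / 2) - 2 * sqrt 2 * ratio_sqrt y)) has_real_derivative
     2 powr (-11/5) * (y powr (-4/5) * (1 - y) powr (-3/5)) * (1 - kappa * s) powr (-3/5)
     + - (2 powr (-11/5) * (y powr (-4/5) * (1 - y) powr (-3/5)) * (1 - (- kappa) * s) powr (-3/5))) (at y)"
    by (rule DERIV_add)
  also have "2 powr (-11/5) * (y powr (-4/5) * (1 - y) powr (-3/5)) * (1 - kappa * s) powr (-3/5)
     + - (2 powr (-11/5) * (y powr (-4/5) * (1 - y) powr (-3/5)) * (1 - (- kappa) * s) powr (-3/5))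
     = 2 powr (-11/5) * binomial_density y"
    by (simp add: binomial_density_def s_def algebra_simps)
  finally show ?thesis
    by (rule has_field_derivative_transform_within_open[where S = "{..<1}"])
       (use y in \<open>auto simp: swept_antideriv_def\<close>)
qed

text \<open>Only y = 1 is delicate: there the two swept points escape to +infinity and -infinity,
  and the limit 0 is the cancellation of the two ends.\<close>

lemma continuous_on_swept_antideriv: "continuous_on {0..1} swept_antideriv"
  unfolding continuous_on_eq_continuous_within
proof
  fix y :: real assume y: "y \<in> {0..1}"
  have vpos: "ratio_sqrt y \<ge> 0" if "0 \<le> y" "y \<le> 1" for y using that by (simp add: ratio_sqrt_def)
  show "continuous (at y within {0..1}) swept_antideriv"
  proof (cases "y = 1")
    case False
    have cv: "continuous_on {0..<1} ratio_sqrt"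
      unfolding ratio_sqrt_def[abs_def] by (intro continuous_intros) auto
    have "continuous_on {0..<1} (\<lambda>y. right_antideriv (- (sqrt 5 / 2) + 2 * sqrt 2 * ratio_sqrt y)
                         + left_antideriv (- (sqrt 5 / 2) - 2 * sqrt 2 * ratio_sqrt y))"
      by (intro continuous_on_add continuous_on_compose2[OF continuous_on_right_antideriv]
            continuous_on_compose2[OF continuous_on_left_antideriv] continuous_intros cv)
         (auto simp: vpos)
    then have "continuous_on {0..<1} swept_antideriv"
      by (subst continuous_on_cong[OF refl]) (auto simp: swept_antideriv_def)
    then have "continuous (at y within {0..<1}) swept_antideriv"
      using y False by (simp add: continuous_on_eq_continuous_within)
    moreover have "at y within {0..<1} = at y within {0..1}"
      by (rule at_within_nhd[of _ "{..<1}"]) (use y False in auto)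
    ultimately show ?thesis by (simp add: continuous_within)
  next
    case True
    have v: "filterlim ratio_sqrt at_top (at_left 1)"
      unfolding ratio_sqrt_def by real_asymp
    have t: "filterlim (\<lambda>y. - (sqrt 5 / 2) + 2 * sqrt 2 * ratio_sqrt y) at_top (at_left 1)"
      by (intro filterlim_tendsto_add_at_top[OF tendsto_const] filterlim_tendsto_pos_mult_at_top[OF tendsto_const _ v]) auto
    have "filterlim (\<lambda>y. - (sqrt 5 / 2 + 2 * sqrt 2 * ratio_sqrt y)) at_bot (at_left 1)"
      unfolding filterlim_uminus_at_bot minus_minus
      by (intro filterlim_tendsto_add_at_top[OF tendsto_const] filterlim_tendsto_pos_mult_at_top[OF tendsto_const _ v]) auto
    then have t': "filterlim (\<lambda>y. - (sqrt 5 / 2) - 2 * sqrt 2 * ratio_sqrt y) at_bot (at_left 1)"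
      by (simp add: algebra_simps)
    have "((\<lambda>y. outer_antideriv (- (sqrt 5 / 2) + 2 * sqrt 2 * ratio_sqrt y)
              - outer_antideriv (- (sqrt 5 / 2) - 2 * sqrt 2 * ratio_sqrt y)) \<longlongrightarrow> 0) (at_left 1)"
      by (rule outer_antideriv_diff_tendsto[OF t t'])
    moreover have "eventually (\<lambda>y. outer_antideriv (- (sqrt 5 / 2) + 2 * sqrt 2 * ratio_sqrt y)
              - outer_antideriv (- (sqrt 5 / 2) - 2 * sqrt 2 * ratio_sqrt y) = swept_antideriv y) (at_left 1)"
    proof -
      have "eventually (\<lambda>y. - (sqrt 5 / 2) + 2 * sqrt 2 * ratio_sqrt y > 2) (at_left 1)"
        using t by (auto simp: filterlim_at_top_dense)
      moreover have "eventually (\<lambda>y. - (sqrt 5 / 2) - 2 * sqrt 2 * ratio_sqrt y < -2) (at_left 1)"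
        using t' by (auto simp: filterlim_at_bot_dense)
      moreover have "eventually (\<lambda>y::real. y < 1) (at_left 1)"
        by (simp add: eventually_at_filter)
      ultimately show ?thesis
        by eventually_elim (simp add: swept_antideriv_def right_antideriv_def left_antideriv_def)
    qed
    ultimately have "(swept_antideriv \<longlongrightarrow> 0) (at_left 1)" by (rule Lim_transform_eventually)
    then have "(swept_antideriv \<longlongrightarrow> swept_antideriv 1) (at 1 within {0..1})"
      by (simp add: swept_antideriv_def at_within_Icc_at_left)
    then show ?thesis using True by (simp add: continuous_within)
  qed
qed

lemma binomial_density_integral:
  "(binomial_density has_integral 4 * sqrt 5 / 3 * Beta (2/5) (2/5)) {0..1}"
proof -
  define w where "w c = (c / (2 * sqrt 2))\<^sup>2" for c :: real
  \<comment> \<open>The parameters at which a swept point can cross a joint, that is 2 sqrt 2 v = 2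
    + sqrt 5 / 2 or 2 - sqrt 5 / 2; here w is v^2 and y = w/(1 + w).\<close>
  define S where "S = {w (2 + sqrt 5 / 2) / (1 + w (2 + sqrt 5 / 2)), w (2 - sqrt 5 / 2) / (1 + w (2 - sqrt 5 / 2))}"
  have ratio: "y = w c / (1 + w c)" if "2 * sqrt 2 * ratio_sqrt y = c" "0 < y" "y < 1" for y c
  proof -
    have "c / (2 * sqrt 2) = ratio_sqrt y" using that by (simp add: field_simps)
    then have "y / (1 - y) = w c" using that by (simp add: w_def ratio_sqrt_def)
    then have "y = w c * (1 - y)" using that by (simp add: field_simps)
    moreover have "1 + w c > 0" by (simp add: w_def add_pos_nonneg)
    ultimately show ?thesis by (simp add: field_simps)
  qed
  have "((\<lambda>y. 2 powr (-11/5) * binomial_density y) has_integral (swept_antideriv 1 - swept_antideriv 0)) {0..1}"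
  proof (rule fundamental_theorem_of_calculus_interior_strong[of S])
    fix y assume y: "y \<in> {0<..<1} - S"
    have "- (sqrt 5 / 2) + 2 * sqrt 2 * ratio_sqrt y \<noteq> 2" "- (sqrt 5 / 2) - 2 * sqrt 2 * ratio_sqrt y \<noteq> -2"
      using y ratio[of y "2 + sqrt 5 / 2"] ratio[of y "2 - sqrt 5 / 2"] by (auto simp: S_def)
    then show "(swept_antideriv has_vector_derivative 2 powr (-11/5) * binomial_density y) (at y)"
      using swept_antideriv_has_derivative[of y] y by (simp add: has_real_derivative_iff_has_vector_derivative)
  qed (auto simp: S_def continuous_on_swept_antideriv)
  \<comment> \<open>The upper end contributes 0; y = 0 is the root, approached from both
    sides.\<close>
  also have "swept_antideriv 1 - swept_antideriv 0 = sqrt 5 / 3 * (2 powr (-1/5) * Beta (2/5) (2/5))"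
    using antideriv_at_root by (simp add: swept_antideriv_def ratio_sqrt_def)
  finally have "((\<lambda>y. 2 powr (11/5) * (2 powr (-11/5) * binomial_density y)) has_integral
      2 powr (11/5) * (sqrt 5 / 3 * (2 powr (-1/5) * Beta (2/5) (2/5)))) {0..1}"
    by (rule has_integral_mult_right)
  also have "(\<lambda>y. 2 powr (11/5) * (2 powr (-11/5) * binomial_density y)) = binomial_density"
    by (simp only: mult.assoc[symmetric] powr_add[symmetric]) simp
  also have "2 powr (11/5) * (sqrt 5 / 3 * (2 powr (-1/5) * Beta (2/5) (2/5)))
      = (2 powr (11/5) * 2 powr (-1/5)) * (sqrt 5 / 3 * Beta (2/5) (2/5))" by (simp add: mult_ac)
  also have "2 powr (11/5) * 2 powr (-1/5) = (4::real)" by (simp only: powr_add[symmetric]) simp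
  finally show ?thesis by (simp add: mult.assoc)
qed

section \<open>Expansion into Gauss's series\<close>

lemma odd_binomial_series:
  fixes a q :: real
  assumes q: "\<bar>q\<bar> < 1"
  shows "(\<lambda>n. 2 * pochhammer a (2 * n + 1) / fact (2 * n + 1) * q ^ (2 * n + 1))
           sums ((1 - q) powr (-a) - (1 + q) powr (-a))"
proof -
  define f where "f n = pochhammer a n / fact n * (q ^ n - (- q) ^ n)" for n
  have b: "(- a gchoose n) * (- x) ^ n = pochhammer a n / fact n * x ^ n" for n and x :: real
    by (simp add: gbinomial_pochhammer power_minus[of x])
  have "(\<lambda>n. pochhammer a n / fact n * q ^ n) sums (1 - q) powr (-a)"
    using gen_binomial_real[of "-q" "-a"] q b[of _ q] by simp
  moreover have "(\<lambda>n. pochhammer a n / fact n * (-q) ^ n) sums (1 + q) powr (-a)"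
    using gen_binomial_real[of "q" "-a"] q b[of _ "-q"] by simp
  ultimately have "(\<lambda>n. pochhammer a n / fact n * q ^ n - pochhammer a n / fact n * (-q) ^ n)
      sums ((1 - q) powr (-a) - (1 + q) powr (-a))"
    by (rule sums_diff)
  then have "f sums ((1 - q) powr (-a) - (1 + q) powr (-a))"
    by (simp only: f_def[abs_def] right_diff_distrib)
  moreover have "f n = 0" if "n \<notin> range (\<lambda>n. 2 * n + 1)" for n
  proof -
    have "even n" using that by (metis oddE rangeI)
    then show ?thesis by (simp add: f_def)
  qed
  ultimately have "(\<lambda>n. f (2 * n + 1)) sums ((1 - q) powr (-a) - (1 + q) powr (-a))"
    by (subst sums_mono_reindex) (auto simp: strict_mono_def)
  moreover have "f (2 * n + 1) = 2 * pochhammer a (2 * n + 1) / fact (2 * n + 1) * q ^ (2 * n + 1)" for n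
    unfolding f_def by simp
  ultimately show ?thesis by (simp only:)
qed

definition beta_coeff :: "nat \<Rightarrow> real" where
  "beta_coeff n = 2 * pochhammer (3/5) (2 * n + 1) / fact (2 * n + 1) * kappa ^ (2 * n + 1)"

lemma beta_coeff_nonneg: "beta_coeff n \<ge> 0"
  using kappa(1) by (simp add: beta_coeff_def pochhammer_nonneg)

lemma binomial_density_sums:
  assumes y: "0 \<le> y" "y \<le> 1"
  shows "(\<lambda>n. beta_coeff n * (y powr (real n + 7/10 - 1) * (1 - y) powr (real n + 9/10 - 1)))
           sums binomial_density y"
proof (cases "y = 0 \<or> y = 1")
  \<comment> \<open>Since \<open>0 powr x = 0\<close>, all terms and the density vanish at the
    endpoints.\<close>
  case True
  then show ?thesis by (auto simp: binomial_density_def)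
next
  case False
  with y have y: "0 < y" "y < 1" by auto
  define s where "s = sqrt (y * (1 - y))"
  have s: "s = y powr (1/2) * (1 - y) powr (1/2)"
    using y by (simp add: s_def powr_half_sqrt real_sqrt_mult)
  have pow: "y powr (-4/5) * (1 - y) powr (-3/5) * s ^ (2 * n + 1)
      = y powr (real n + 7/10 - 1) * (1 - y) powr (real n + 9/10 - 1)" for n
  proof -
    have h: "(z powr (1/2)) ^ (2 * n + 1) = z powr (real n + 1/2)" if "z > 0" for z :: real
    proof -
      have "(z powr (1/2)) ^ (2 * n + 1) = (z powr (1/2)) powr real (2 * n + 1)"
        using that by (intro powr_realpow[symmetric]) simp
      also have "\<dots> = z powr (1/2 * real (2 * n + 1))" by (rule powr_powr)
      also have "1/2 * real (2 * n + 1) = real n + 1/2" by simp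
      finally show ?thesis .
    qed
    have "y powr (-4/5) * (1 - y) powr (-3/5) * s ^ (2 * n + 1)
      = (y powr (-4/5) * y powr (real n + 1/2)) * ((1 - y) powr (-3/5) * (1 - y) powr (real n + 1/2))"
      unfolding s power_mult_distrib using y by (simp only: h) (simp add: h mult_ac)
    also have "\<dots> = y powr (real n + 7/10 - 1) * (1 - y) powr (real n + 9/10 - 1)"
      by (simp only: powr_add[symmetric]) (simp add: algebra_simps)
    finally show ?thesis .
  qed
  have "\<bar>kappa * s\<bar> < 1" using kappa_sqrt_less_1[of y] y by (simp add: s_def)
  from sums_mult[OF odd_binomial_series[OF this, of "3/5"], of "y powr (-4/5) * (1 - y) powr (-3/5)"]
  have "(\<lambda>n. y powr (-4/5) * (1 - y) powr (-3/5) * (2 * pochhammer (3/5) (2 * n + 1) / fact (2 * n + 1)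
           * (kappa * s) ^ (2 * n + 1))) sums binomial_density y"
    by (simp add: binomial_density_def s_def)
  also have "(\<lambda>n. y powr (-4/5) * (1 - y) powr (-3/5) * (2 * pochhammer (3/5) (2 * n + 1) / fact (2 * n + 1)
           * (kappa * s) ^ (2 * n + 1)))
     = (\<lambda>n. beta_coeff n * (y powr (-4/5) * (1 - y) powr (-3/5) * s ^ (2 * n + 1)))"
    unfolding beta_coeff_def power_mult_distrib by (intro ext) (simp only: mult_ac times_divide_eq_left times_divide_eq_right)
  finally show ?thesis by (simp only: pow)
qed

text \<open>All terms are nonnegative, so monotone convergence justifies termwise integration; the
  known integral of the density itself bounds the partial sums.\<close>

lemma beta_series:
  "(\<lambda>n. beta_coeff n * Beta (real n + 7/10) (real n + 9/10)) sums (4 * sqrt 5 / 3 * Beta (2/5) (2/5))"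
proof -
  define t where "t n y = beta_coeff n * (y powr (real n + 7/10 - 1) * (1 - y) powr (real n + 9/10 - 1))" for n y
  define f where "f N y = (\<Sum>n<N. t n y)" for N y
  have t: "(t n has_integral beta_coeff n * Beta (real n + 7/10) (real n + 9/10)) {0..1}" for n
    unfolding t_def[abs_def] by (intro has_integral_mult_right has_integral_Beta_real) auto
  have f: "(f N has_integral (\<Sum>n<N. beta_coeff n * Beta (real n + 7/10) (real n + 9/10))) {0..1}" for N
    unfolding f_def[abs_def] by (intro has_integral_sum t) auto
  have t0: "t n y \<ge> 0" for n y by (simp add: t_def beta_coeff_nonneg)
  have sums: "(\<lambda>n. t n y) sums binomial_density y" if "y \<in> {0..1}" for y
    unfolding t_def using that by (intro binomial_density_sums) auto
  have le: "f N y \<le> binomial_density y" if "y \<in> {0..1}" for N y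
    unfolding f_def using sums[OF that] t0 by (metis finite_lessThan sum_le_suminf sums_iff)
  have int: "integral {0..1} (f N) = (\<Sum>n<N. beta_coeff n * Beta (real n + 7/10) (real n + 9/10))" for N
    using f by (rule integral_unique)
  have "(\<lambda>N. integral {0..1} (f N)) \<longlonglongrightarrow> integral {0..1} binomial_density"
  proof (rule monotone_convergence_increasing[THEN conjunct2])
    show "f N integrable_on {0..1}" for N using f by blast
    show "f N y \<le> f (Suc N) y" if "y \<in> {0..1}" for N y by (simp add: f_def t0)
    show "(\<lambda>N. f N y) \<longlonglongrightarrow> binomial_density y" if "y \<in> {0..1}" for y
      using sums[OF that] by (simp add: sums_def f_def)
    have bnd: "\<bar>integral {0..1} (f N)\<bar> \<le> 4 * sqrt 5 / 3 * Beta (2/5) (2/5)" for N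
    proof -
      have "integral {0..1} (f N) \<ge> 0"
        using f by (intro integral_nonneg) (auto simp: f_def t0 sum_nonneg)
      moreover have "integral {0..1} (f N) \<le> 4 * sqrt 5 / 3 * Beta (2/5) (2/5)"
        unfolding int by (rule has_integral_le[OF f binomial_density_integral le])
      ultimately show ?thesis by simp
    qed
    show "bounded (range (\<lambda>N. integral {0..1} (f N)))"
    proof (rule boundedI)
      fix x assume "x \<in> range (\<lambda>N. integral {0..1} (f N))"
      then obtain N where "x = integral {0..1} (f N)" by blast
      then show "norm x \<le> 4 * sqrt 5 / 3 * Beta (2/5) (2/5)" using bnd[of N] by (simp only: real_norm_def)
    qed
  qed
  then show ?thesis
    by (simp add: sums_def int integral_unique[OF binomial_density_integral])
qed

lemma fact_odd: "fact (2 * n + 1) = 4 ^ n * fact n * pochhammer (3/2 :: real) n"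
proof (induction n)
  case (Suc n)
  have "fact (2 * Suc n + 1) = (2 * real n + 3) * (2 * real n + 2) * fact (2 * n + 1)"
    by (simp add: algebra_simps)
  then show ?case unfolding Suc by (simp add: pochhammer_Suc field_simps)
qed simp

text \<open>Gamma(2n + 8/5) from the Pochhammer symbol cancels the denominator of the Beta value.
  The 4^n in (2n + 1)! divides kappa^(2n) = (125/32)^n and leaves (125/128)^n.\<close>

lemma beta_coeff_Beta:
  "beta_coeff n * Beta (real n + 7/10) (real n + 9/10)
     = 2 * kappa * Gamma (7/10) * Gamma (9/10) / Gamma (3/5)
       * (pochhammer (9/10) n * pochhammer (7/10) n / (pochhammer (3/2) n * fact n) * (125/128) ^ n)"
proof -
  have notin: "x \<notin> \<int>\<^sub>\<le>\<^sub>0" if "x > 0" for x :: real using that by (auto elim!: nonpos_Ints_cases)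
  have g: "Gamma (real n + x) = pochhammer x n * Gamma x" if "x > 0" for x n
    using pochhammer_Gamma[OF notin[OF that], of n] Gamma_real_pos[OF that] by (simp add: add.commute)
  have p: "pochhammer (3/5) (2 * n + 1) = Gamma (2 * real n + 8/5) / Gamma (3/5)"
    by (subst pochhammer_Gamma) (auto simp: notin add_ac)
  have b: "Beta (real n + 7/10) (real n + 9/10)
      = pochhammer (7/10) n * Gamma (7/10) * (pochhammer (9/10) n * Gamma (9/10)) / Gamma (2 * real n + 8/5)"
    by (simp add: Beta_def g add_ac)
  define G where "G = Gamma (2 * real n + 8/5)"
  have G: "G > 0" unfolding G_def by (intro Gamma_real_pos) auto
  have "kappa ^ (2 * n + 1) = kappa * (125/32) ^ n"
    by (simp add: power_mult kappa(2))
  also have "(125/32 :: real) ^ n = (125/128) ^ n * 4 ^ n"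
    by (simp flip: power_mult_distrib)
  finally have k: "kappa ^ (2 * n + 1) = kappa * ((125/128) ^ n * 4 ^ n)" .
  show ?thesis
    unfolding beta_coeff_def fact_odd p b k G_def[symmetric] using G by (simp add: field_simps)
qed

section \<open>Reduction of the Gamma quotient to Gamma(1/5) and Gamma(2/5)\<close>

lemma Gamma_reflection_real: "Gamma x * Gamma (1 - x) = pi / sin (pi * x)" for x :: real
proof -
  have e: "1 - complex_of_real x = of_real (1 - x)" by simp
  have "complex_of_real (Gamma x * Gamma (1 - x)) = Gamma (of_real x) * Gamma (1 - of_real x)"
    unfolding e by (simp only: Gamma_complex_of_real of_real_mult)
  also have "\<dots> = of_real (pi / sin (pi * x))"
    unfolding Gamma_reflection_complex by (simp flip: sin_of_real)
  finally show ?thesis by (simp only: of_real_eq_iff)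
qed

lemma Gamma_duplication_real:
  fixes x :: real
  assumes "x > 0"
  shows "Gamma x * Gamma (x + 1/2) = 2 powr (1 - 2 * x) * sqrt pi * Gamma (2 * x)"
proof -
  have notin: "complex_of_real u \<notin> \<int>\<^sub>\<le>\<^sub>0" if "u > 0" for u :: real
    using that by (auto elim!: nonpos_Ints_cases simp: complex_eq_iff)
  have e: "complex_of_real x + 1/2 = of_real (x + 1/2)" "2 * complex_of_real x = of_real (2 * x)" by simp_all
  have "complex_of_real (Gamma x * Gamma (x + 1/2)) = Gamma (of_real x) * Gamma (of_real x + 1/2)"
    unfolding e by (simp only: Gamma_complex_of_real of_real_mult)
  also have "\<dots> = exp ((1 - 2 * of_real x) * of_real (ln 2)) * of_real (sqrt pi) * Gamma (2 * of_real x)"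
    using notin[of x] notin[of "x + 1/2"] assms by (intro Gamma_legendre_duplication) auto
  also have "exp ((1 - 2 * complex_of_real x) * of_real (ln 2)) = of_real (2 powr (1 - 2 * x))"
    by (simp add: powr_def flip: exp_of_real)
  also have "\<dots> * of_real (sqrt pi) * Gamma (2 * of_real x) = of_real (2 powr (1 - 2 * x) * sqrt pi * Gamma (2 * x))"
    unfolding e by (simp only: Gamma_complex_of_real, simp only: of_real_mult)
  finally show ?thesis by (simp only: of_real_eq_iff)
qed

text \<open>Reflection at 1/5 and 2/5 and duplication at 1/5 and 2/5 express every Gamma value by
  \<open>A\<close>, \<open>B\<close> and the sines of pi/5 and 2 pi/5. The power of 5 + sqrt 5 is
  what remains of \<open>s1\<^sup>2 / s2\<close>.\<close>

lemma special_value_constant: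
  "(3/128) powr (1/10) * (4 * sqrt 5 / 3 * Beta (2/5) (2/5) / (2 * kappa * Gamma (7/10) * Gamma (9/10) / Gamma (3/5)))
     = 4/3 * ((sqrt 2 * root 10 3 * Gamma (1/5) ^ 3 * Gamma (2/5)) / ((5 + sqrt 5) powr (3/2) * pi ^ 2))"
proof -
  define A B where "A = Gamma (1/5 :: real)" and "B = Gamma (2/5 :: real)"
  define s1 s2 where "s1 = sin (pi / 5)" and "s2 = sin (2 * (pi / 5))"
  have pos: "A > 0" "B > 0" by (simp_all add: A_def B_def Gamma_real_pos)
  have s1: "s1 > 0" "s1\<^sup>2 = (5 - sqrt 5) / 8"
  proof -
    show "s1 > 0" unfolding s1_def by (intro sin_gt_zero) auto
    show "s1\<^sup>2 = (5 - sqrt 5) / 8"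
      unfolding s1_def sin_squared_eq cos_pi_5 by (simp add: power2_eq_square field_simps)
  qed
  have s2: "s2 > 0" "s2\<^sup>2 = (5 + sqrt 5) / 8"
  proof -
    show "s2 > 0" unfolding s2_def by (intro sin_gt_zero) auto
    have "s2\<^sup>2 = 4 * s1\<^sup>2 * (cos (pi / 5))\<^sup>2" unfolding s2_def s1_def sin_double power_mult_distrib by simp
    then show "s2\<^sup>2 = (5 + sqrt 5) / 8"
      unfolding s1 cos_pi_5 by (simp add: power2_eq_square field_simps)
  qed
  have "A * Gamma (4/5) = pi / s1"
    using Gamma_reflection_real[of "1/5"] by (simp add: A_def s1_def)
  then have G45: "Gamma (4/5) = pi / (s1 * A)" using pos s1(1) by (simp add: field_simps)
  have "B * Gamma (3/5) = pi / s2"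
    using Gamma_reflection_real[of "2/5"] by (simp add: B_def s2_def mult.commute)
  then have G35: "Gamma (3/5) = pi / (s2 * B)" using pos s2(1) by (simp add: field_simps)
  have "A * Gamma (7/10) = 2 powr (3/5) * sqrt pi * B"
    using Gamma_duplication_real[of "1/5"] by (simp add: A_def B_def)
  then have G710: "Gamma (7/10) = 2 powr (3/5) * sqrt pi * B / A" using pos by (simp add: field_simps)
  have "B * Gamma (9/10) = 2 powr (1/5) * sqrt pi * Gamma (4/5)"
    using Gamma_duplication_real[of "2/5"] by (simp add: B_def)
  then have G910: "Gamma (9/10) = 2 powr (1/5) * sqrt pi * pi / (s1 * A * B)"
    unfolding G45 using pos s1(1) by (simp add: field_simps)
  have BB: "Beta (2/5) (2/5 :: real) = B ^ 2 * (s1 * A) / pi"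
    by (simp add: Beta_def G45 B_def[symmetric] power2_eq_square)
  have pw: "2 powr (3/5) * 2 powr (1/5) = (2 powr (4/5) :: real)"
    by (simp only: powr_add[symmetric]) simp
  have "(4 * sqrt 5 / 3 * Beta (2/5) (2/5) / (2 * kappa * Gamma (7/10) * Gamma (9/10) / Gamma (3/5)))
     = 4/3 * (sqrt 5 / (2 * kappa)) * (s1\<^sup>2 / s2) / (2 powr (3/5) * 2 powr (1/5)) * (A ^ 3 * B) / ((sqrt pi)\<^sup>2 * pi)"
    unfolding BB G710 G910 G35 using pos s1(1) s2(1) kappa(1) pi_gt_zero
    by (simp add: field_simps power2_eq_square power3_eq_cube)
  also have "\<dots> = 4/3 * (sqrt 5 / (2 * kappa)) * (s1\<^sup>2 / s2) / 2 powr (4/5) * (A ^ 3 * B) / pi ^ 2"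
    unfolding pw by (simp add: power2_eq_square)
  finally have L: "(4 * sqrt 5 / 3 * Beta (2/5) (2/5) / (2 * kappa * Gamma (7/10) * Gamma (9/10) / Gamma (3/5)))
     = 4/3 * (sqrt 5 / (2 * kappa)) * (s1\<^sup>2 / s2) / 2 powr (4/5) * (A ^ 3 * B) / pi ^ 2" .
  have r3: "root 10 3 = 3 powr (1/10)" by (simp add: root_powr_inverse)
  have "(3/128 :: real) powr (1/10) = 3 powr (1/10) / (2 powr 7) powr (1/10)"
    by (simp add: powr_divide)
  also have "(2 powr 7 :: real) powr (1/10) = 2 powr (7/10)" by (simp only: powr_powr) simp
  finally have p: "(3/128 :: real) powr (1/10) = 3 powr (1/10) / 2 powr (7/10)" .
  have "2 powr (7/10) * 2 powr (4/5) = (2 powr (3/2) :: real)"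
    by (simp only: powr_add[symmetric]) simp
  also have "\<dots> = 2 powr 1 * 2 powr (1/2)" by (simp only: powr_add[symmetric]) simp
  also have "\<dots> = 2 * sqrt 2" by (simp add: powr_half_sqrt)
  finally have q: "2 powr (7/10) * 2 powr (4/5) = 2 * sqrt (2 :: real)" .
  have k: "sqrt 5 / (2 * kappa) = 4 / (5 * sqrt 2)"
  proof -
    have k: "kappa = 5 * (sqrt 2 * sqrt 5) / 8" by (simp add: kappa_def flip: real_sqrt_mult)
    show ?thesis unfolding k by (simp add: field_simps)
  qed
  \<comment> \<open>The half-integral power comes from 5 + sqrt 5 = 8 s2^2.\<close>
  have c: "(5 + sqrt 5) powr (3/2) = (5 + sqrt 5) * (sqrt 8 * s2)"
  proof -
    have "(5 + sqrt 5) powr (3/2) = (5 + sqrt 5) powr 1 * (5 + sqrt 5) powr (1/2)"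
      by (simp only: powr_add[symmetric]) simp
    also have "\<dots> = (5 + sqrt 5) * sqrt (5 + sqrt 5)" by (simp add: powr_half_sqrt add_nonneg_nonneg)
    also have "5 + sqrt 5 = 8 * s2\<^sup>2" using s2 by simp
    then have "sqrt (5 + sqrt 5) = sqrt 8 * s2" using s2(1) by (simp add: real_sqrt_mult)
    finally show ?thesis .
  qed
  have s8: "sqrt 8 = 2 * sqrt 2" using real_sqrt_mult[of 4 2] by simp
  have m: "(5 - sqrt 5) * (5 + sqrt 5) = 20" by (simp add: algebra_simps)
  have main: "sqrt 5 / (2 * kappa) * (s1\<^sup>2 / s2) / (2 powr (7/10) * 2 powr (4/5)) = sqrt 2 / (5 + sqrt 5) powr (3/2)"
  proof -
    have nz: "5 + sqrt 5 \<noteq> 0" by (smt (verit) real_sqrt_ge_zero)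
    have "(5 - sqrt 5) = 20 / (5 + sqrt 5)" using m nz by (simp add: field_simps)
    then have s1': "s1\<^sup>2 = 20 / (5 + sqrt 5) / 8" using s1(2) by simp
    define d Q where "d = 5 + sqrt 5" and "Q = sqrt 2"
    have d: "d \<noteq> 0" and Q: "Q > 0" "Q * Q = 2" using nz by (simp_all add: d_def Q_def)
    have "4 / (5 * Q) * (20 / d / 8 / s2) / (2 * Q) = 1 / (Q * Q * (d * s2))"
      using d Q(1) s2(1) by (simp add: field_simps)
    also have "\<dots> = Q / (d * (2 * Q * s2))"
      unfolding Q(2) using d Q(1) s2(1) by (simp add: field_simps)
    finally show ?thesis unfolding q k c s8 s1' d_def Q_def .
  qed
  have "(3/128) powr (1/10) * (4 * sqrt 5 / 3 * Beta (2/5) (2/5) / (2 * kappa * Gamma (7/10) * Gamma (9/10) / Gamma (3/5)))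
    = 4/3 * ((sqrt 5 / (2 * kappa) * (s1\<^sup>2 / s2) / (2 powr (7/10) * 2 powr (4/5))) * 3 powr (1/10) * (A ^ 3 * B) / pi ^ 2)"
    unfolding L p by (simp add: mult_ac)
  also have "\<dots> = 4/3 * ((sqrt 2 * root 10 3 * A ^ 3 * B) / ((5 + sqrt 5) powr (3/2) * pi ^ 2))"
    unfolding main r3 by simp
  finally show ?thesis by (simp only: A_def B_def)
qed

theorem mainTheorem19:
  shows "gauss_2F1 (3/5) (4/5) (3/2) (125/128) =
    complex_of_real
      (4/3 * ((sqrt 2 * root 10 3 * Gamma (1/5) ^ 3 * Gamma (2/5)) /
              ((5 + sqrt 5) powr (3/2) * pi ^ 2)))"
proof -
  define K :: real where "K = 2 * kappa * Gamma (7/10) * Gamma (9/10) / Gamma (3/5)"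
  define R :: real where "R = 4 * sqrt 5 / 3 * Beta (2/5) (2/5) / K"
  have K: "K \<noteq> 0"
  proof -
    have "Gamma x \<noteq> 0" if "x > 0" for x :: real using Gamma_real_pos[OF that] by simp
    then show ?thesis using kappa(1) by (simp add: K_def)
  qed
  have "(\<lambda>n. K * (pochhammer (9/10) n * pochhammer (7/10) n / (pochhammer (3/2) n * fact n) * (125/128) ^ n))
      sums (4 * sqrt 5 / 3 * Beta (2/5) (2/5))"
    using beta_series unfolding beta_coeff_Beta K_def .
  then have "(\<lambda>n. inverse K * (K * (pochhammer (9/10) n * pochhammer (7/10) n / (pochhammer (3/2) n * fact n) * (125/128) ^ n)))
      sums (inverse K * (4 * sqrt 5 / 3 * Beta (2/5) (2/5)))"
    by (rule sums_mult)
  then have "(\<lambda>n. pochhammer (9/10) n * pochhammer (7/10) n / (pochhammer (3/2) n * fact n) * (125/128) ^ n) sums R"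
    using K by (simp add: R_def field_simps)
  then have "(\<lambda>n. complex_of_real (pochhammer (9/10) n * pochhammer (7/10) n / (pochhammer (3/2) n * fact n) * (125/128) ^ n)) sums of_real R"
    by (rule sums_of_real)
  moreover have "complex_of_real (pochhammer (9/10) n * pochhammer (7/10) n / (pochhammer (3/2) n * fact n) * (125/128) ^ n)
     = pochhammer (9/10) n * pochhammer (7/10) n / (pochhammer (3/2) n * pochhammer 1 n) * (125/128) ^ n" for n
    using pochhammer_of_real[of "9/10" n, where ?'a = complex] pochhammer_of_real[of "7/10" n, where ?'a = complex]
      pochhammer_of_real[of "3/2" n, where ?'a = complex] by (simp flip: pochhammer_fact)
  ultimately have g: "gauss_2F1 (9/10) (7/10) (3/2) (125/128) = of_real R"
    unfolding gauss_2F1_def by (simp add: sums_iff)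
  have ne: "Re a > 0 \<Longrightarrow> a \<noteq> - of_nat n" for a n by auto
  have "gauss_2F1 (3/5) (4/5) (3/2) (125/128)
      = (1 - 125/128) powr (3/2 - 3/5 - 4/5) * gauss_2F1 (3/2 - 3/5) (3/2 - 4/5) (3/2) (125/128)"
    by (intro gauss_2F1_euler ne) simp_all
  also have "\<dots> = of_real (3/128) powr of_real (1/10) * gauss_2F1 (9/10) (7/10) (3/2) (125/128)" by simp
  also have "of_real (3/128) powr of_real (1/10) = complex_of_real ((3/128) powr (1/10))"
    by (intro powr_of_real) simp
  also have "complex_of_real ((3/128) powr (1/10)) * gauss_2F1 (9/10) (7/10) (3/2) (125/128)
     = of_real ((3/128) powr (1/10) * R)" unfolding g by simp
  also have "(3/128) powr (1/10) * R = 4/3 * ((sqrt 2 * root 10 3 * Gamma (1/5) ^ 3 * Gamma (2/5)) /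
              ((5 + sqrt 5) powr (3/2) * pi ^ 2))"
    unfolding R_def K_def by (rule special_value_constant)
  finally show ?thesis .
qed

end
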